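(* Let $(A,\mathfrak{m},k)$ be a Noetherian local ring such that $k$ is algebraically closed of characteristic $0$, and let $I$ be an $\mathfrak{m}$-primary ideal. If $J$ is any minimal reduction of $I$, then $J+I_>={}^*J$.
   Context: $\overline{v}_I(a)=\lim_{n\to\infty}\operatorname{ord}_I(a^n)/n$ where $\operatorname{ord}_I(a)=\max\{n: a\in I^n\}$ ($\infty$ if $a\in\bigcap_nI^n$); $I_>=\{a\in A\mid\overline{v}_I(a)>1\}$. A reduction of $I$ is an ideal $J\subseteq I$ with $\overline{J}=\overline{I}$; a minimal reduction is one minimal with respect to inclusion. ${}^*J$ is the weak subintegral closure of $J$: $b\in A$ lies in ${}^*J$ if there exist $q\in\mathbb{N}$ and $a_i\in J^i$ ($1\le i\le 2q+1$) with $b^n+\sum_{i=1}^n\binom{n}{i}a_ib^{n-i}=0$ for $q+1\le n\le 2q+1$. *)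

theory Defs
  imports "HOL-Analysis.Analysis"
begin

definition is_ideal :: "'a::comm_ring_1 set \<Rightarrow> bool" where
  "is_ideal I \<longleftrightarrow> 0 \<in> I \<and> (\<forall>x\<in>I. \<forall>y\<in>I. x + y \<in> I) \<and> (\<forall>r. \<forall>x\<in>I. r * x \<in> I)"

definition ideal_gen :: "'a::comm_ring_1 set \<Rightarrow> 'a set" where
  "ideal_gen S = \<Inter>{I. is_ideal I \<and> S \<subseteq> I}"

definition ideal_prod :: "'a::comm_ring_1 set \<Rightarrow> 'a set \<Rightarrow> 'a set" where
  "ideal_prod I J = ideal_gen {a * b | a b. a \<in> I \<and> b \<in> J}"

fun ideal_pow :: "'a::comm_ring_1 set \<Rightarrow> nat \<Rightarrow> 'a set" where
  "ideal_pow I 0 = UNIV"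
| "ideal_pow I (Suc n) = ideal_prod I (ideal_pow I n)"

definition noetherian_ring :: "'a::comm_ring_1 itself \<Rightarrow> bool" where
  "noetherian_ring _ \<longleftrightarrow> (\<forall>I::'a set. is_ideal I \<longrightarrow> (\<exists>F. finite F \<and> I = ideal_gen F))"

definition local_ring_max :: "'a::comm_ring_1 set \<Rightarrow> bool" where
  "local_ring_max m \<longleftrightarrow> is_ideal m \<and> m \<noteq> UNIV \<and>
     (\<forall>I. is_ideal I \<and> I \<noteq> UNIV \<longrightarrow> I \<subseteq> m)"

text \<open>The residue field A/m is algebraically closed: every monic polynomial of positive
  degree over A/m has a root in A/m (lifted to representatives in A).\<close>
definition residue_field_alg_closed :: "'a::comm_ring_1 set \<Rightarrow> bool" where
  "residue_field_alg_closed m \<longleftrightarrow>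
     (\<forall>n::nat. \<forall>c::nat \<Rightarrow> 'a. n \<ge> 1 \<longrightarrow> (\<exists>x. x ^ n + (\<Sum>i<n. c i * x ^ i) \<in> m))"

definition residue_field_char_0 :: "'a::comm_ring_1 set \<Rightarrow> bool" where
  "residue_field_char_0 m \<longleftrightarrow> (\<forall>n::nat. n \<ge> 1 \<longrightarrow> of_nat n \<notin> m)"

definition ideal_radical :: "'a::comm_ring_1 set \<Rightarrow> 'a set" where
  "ideal_radical I = {a. \<exists>n. a ^ n \<in> I}"

definition primary_ideal :: "'a::comm_ring_1 set \<Rightarrow> bool" where
  "primary_ideal I \<longleftrightarrow> is_ideal I \<and> I \<noteq> UNIV \<and>
     (\<forall>a b. a * b \<in> I \<longrightarrow> a \<in> I \<or> b \<in> ideal_radical I)"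

definition m_primary :: "'a::comm_ring_1 set \<Rightarrow> 'a set \<Rightarrow> bool" where
  "m_primary m I \<longleftrightarrow> primary_ideal I \<and> ideal_radical I = m"

definition ord_ideal :: "'a::comm_ring_1 set \<Rightarrow> 'a \<Rightarrow> enat" where
  "ord_ideal I a = (if (\<forall>n. a \<in> ideal_pow I n) then \<infinity>
                    else enat (GREATEST n. a \<in> ideal_pow I n))"

definition vbar :: "'a::comm_ring_1 set \<Rightarrow> 'a \<Rightarrow> ereal" where
  "vbar I a = lim (\<lambda>n. ereal_of_enat (ord_ideal I (a ^ n)) / ereal (real n))"

definition I_gt :: "'a::comm_ring_1 set \<Rightarrow> 'a set" where
  "I_gt I = {a. vbar I a > 1}"

definition int_closure :: "'a::comm_ring_1 set \<Rightarrow> 'a set" where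
  "int_closure I = {b. \<exists>n::nat. \<exists>a::nat \<Rightarrow> 'a. n \<ge> 1 \<and>
      (\<forall>i\<in>{1..n}. a i \<in> ideal_pow I i) \<and>
      b ^ n + (\<Sum>i=1..n. a i * b ^ (n - i)) = 0}"

definition is_reduction :: "'a::comm_ring_1 set \<Rightarrow> 'a set \<Rightarrow> bool" where
  "is_reduction J I \<longleftrightarrow> is_ideal J \<and> J \<subseteq> I \<and> int_closure J = int_closure I"

definition is_minimal_reduction :: "'a::comm_ring_1 set \<Rightarrow> 'a set \<Rightarrow> bool" where
  "is_minimal_reduction J I \<longleftrightarrow> is_reduction J I \<and>
     (\<forall>K. is_reduction K I \<and> K \<subseteq> J \<longrightarrow> K = J)"

definition weak_subint_closure :: "'a::comm_ring_1 set \<Rightarrow> 'a set" where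
  "weak_subint_closure J = {b. \<exists>q::nat. \<exists>a::nat \<Rightarrow> 'a.
      (\<forall>i\<in>{1..2*q+1}. a i \<in> ideal_pow J i) \<and>
      (\<forall>n\<in>{q+1..2*q+1}. b ^ n + (\<Sum>i=1..n. of_nat (n choose i) * a i * b ^ (n - i)) = 0)}"

definition ideal_sum :: "'a::comm_ring_1 set \<Rightarrow> 'a set \<Rightarrow> 'a set" where
  "ideal_sum I J = ideal_gen (I \<union> J)"

end

theory Submission
  imports Defs "HOL-Computational_Algebra.Polynomial"
begin

text \<open>
  For \<open>J + I\<^sub>> \<subseteq> \<^sup>*J\<close>: an element \<open>c\<close> of \<open>I\<^sub>>\<close> satisfies \<open>c ^ k \<in> J ^ k\<close> for all large \<open>k\<close>,
  and then coefficients witnessing \<open>j + c \<in> \<^sup>*J\<close> can be written down.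

  For the converse, let \<open>x\<^sub>0, \<dots>\<close> be a least generating system of \<open>J\<close> and write the coefficients
  \<open>a\<^sub>i\<close> of \<open>b \<in> \<^sup>*J\<close> as forms in it, with reductions \<open>f\<^sub>i\<close> over the residue field. Since \<open>J\<close> has no
  proper reduction, at every point \<open>l\<close> of affine space there is a value \<open>\<beta> l\<close> satisfying the
  specialised equations, that is, a root of multiplicity at least \<open>q + 1\<close> of a polynomial of
  degree \<open>2 * q + 1\<close>. Such a root is unique, and along each line it is a rational function of the
  parameter, integral over the polynomials, hence affine-linear. So \<open>\<beta>\<close> is a linear form, represented
  by some \<open>j \<in> J\<close>. After the translation \<open>c = b - j\<close> the forms of degrees \<open>q + 1, \<dots>, 2 * q + 1\<close>
  have coefficients in the maximal ideal, and a finite difference argument gives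
  \<open>c ^ (2 * q + 1) \<in> M * (J + (c)) ^ (2 * q + 1)\<close>, whence \<open>c \<in> I\<^sub>>\<close>.
\<close>

subsection \<open>The semiring of ideals\<close>

lemma is_idealD:
  assumes "is_ideal I"
  shows is_ideal_0: "0 \<in> I"
    and is_ideal_add: "x \<in> I \<Longrightarrow> y \<in> I \<Longrightarrow> x + y \<in> I"
    and is_ideal_mult: "x \<in> I \<Longrightarrow> r * x \<in> I"
    and is_ideal_mult_right: "x \<in> I \<Longrightarrow> x * r \<in> I"
  using assms by (auto simp: is_ideal_def mult.commute[of x])

lemma is_ideal_ideal_gen: "is_ideal (ideal_gen S)"
  unfolding ideal_gen_def is_ideal_def by blast

lemma ideal_gen_superset: "S \<subseteq> ideal_gen S"
  unfolding ideal_gen_def by blast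

lemma ideal_gen_least: "is_ideal I \<Longrightarrow> S \<subseteq> I \<Longrightarrow> ideal_gen S \<subseteq> I"
  unfolding ideal_gen_def by blast

typedef (overloaded) 'a idl = "{I::'a::comm_ring_1 set. is_ideal I}"
  morphisms elts Idl
  by (rule exI[of _ UNIV]) (simp add: is_ideal_def)

lemmas is_ideal_elts [simp] = elts[simplified]
lemmas elts_Idl = Idl_inverse[simplified]
lemmas elts_rules = is_idealD[OF is_ideal_elts]

lemma elts_uminus: "x \<in> elts I \<Longrightarrow> - x \<in> elts I"
  using elts_rules(3)[of x I "-1"] by simp

lemma elts_diff: "x \<in> elts I \<Longrightarrow> y \<in> elts I \<Longrightarrow> x - y \<in> elts I"
  using elts_rules(2)[of x I "-y"] elts_uminus[of y] by simp

lemma elts_sum: "(\<And>i. i \<in> S \<Longrightarrow> f i \<in> elts I) \<Longrightarrow> sum f S \<in> elts I"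
  by (induction S rule: infinite_finite_induct) (auto intro: elts_rules)

instantiation idl :: (comm_ring_1) "{comm_semiring_1, canonically_ordered_monoid_add}"
begin

definition zero_idl :: "'a idl" where "0 = Idl {0}"
definition one_idl :: "'a idl" where "1 = Idl UNIV"
definition plus_idl :: "'a idl \<Rightarrow> 'a idl \<Rightarrow> 'a idl"
  where "I + J = Idl {a + b | a b. a \<in> elts I \<and> b \<in> elts J}"
definition times_idl :: "'a idl \<Rightarrow> 'a idl \<Rightarrow> 'a idl"
  where "I * J = Idl (ideal_prod (elts I) (elts J))"
definition less_eq_idl :: "'a idl \<Rightarrow> 'a idl \<Rightarrow> bool"
  where "I \<le> J \<longleftrightarrow> elts I \<subseteq> elts J"
definition less_idl :: "'a idl \<Rightarrow> 'a idl \<Rightarrow> bool"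
  where "I < J \<longleftrightarrow> elts I \<subset> elts J"

lemma elts_zero: "elts (0::'a idl) = {0}"
  unfolding zero_idl_def by (rule elts_Idl) (simp add: is_ideal_def)

lemma elts_one: "elts (1::'a idl) = UNIV"
  unfolding one_idl_def by (rule elts_Idl) (simp add: is_ideal_def)

lemma elts_plus: "elts (I + J :: 'a idl) = {a + b | a b. a \<in> elts I \<and> b \<in> elts J}"
  unfolding plus_idl_def
proof (rule elts_Idl, unfold is_ideal_def, intro conjI ballI allI)
  show "0 \<in> {a + b |a b. a \<in> elts I \<and> b \<in> elts J}"
    using elts_rules(1) by force
next
  fix x y assume "x \<in> {a + b |a b. a \<in> elts I \<and> b \<in> elts J}"
    "y \<in> {a + b |a b. a \<in> elts I \<and> b \<in> elts J}"
  then obtain a b c d where "x = a + b" "y = c + d" "a \<in> elts I" "b \<in> elts J" "c \<in> elts I" "d \<in> elts J"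
    by blast
  then have "x + y = (a + c) + (b + d)" "a + c \<in> elts I" "b + d \<in> elts J"
    by (auto intro: elts_rules)
  then show "x + y \<in> {a + b |a b. a \<in> elts I \<and> b \<in> elts J}" by blast
next
  fix r x assume "x \<in> {a + b |a b. a \<in> elts I \<and> b \<in> elts J}"
  then show "r * x \<in> {a + b |a b. a \<in> elts I \<and> b \<in> elts J}"
    using elts_rules(3)[of _ I r] elts_rules(3)[of _ J r] by (auto simp: distrib_left) blast
qed

lemma elts_times: "elts (I * J :: 'a idl) = ideal_prod (elts I) (elts J)"
  unfolding times_idl_def by (rule elts_Idl) (simp add: ideal_prod_def is_ideal_ideal_gen)

lemma elts_times_le_iff:
  "(I * J :: 'a idl) \<le> L \<longleftrightarrow> (\<forall>a\<in>elts I. \<forall>b\<in>elts J. a * b \<in> elts L)"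
  unfolding less_eq_idl_def elts_times ideal_prod_def
  using ideal_gen_superset[of "{a * b |a b. a \<in> elts I \<and> b \<in> elts J}"]
    ideal_gen_least[OF is_ideal_elts[of L], of "{a * b |a b. a \<in> elts I \<and> b \<in> elts J}"]
  by blast

lemma elts_timesI: "a \<in> elts I \<Longrightarrow> b \<in> elts J \<Longrightarrow> a * b \<in> elts (I * J :: 'a idl)"
  using elts_times_le_iff[of I J "I * J"] by (auto simp: less_eq_idl_def)

lemma idl_eqI: "elts I = elts J \<Longrightarrow> I = (J :: 'a idl)"
  by (simp add: elts_inject)

lemma idl_leD: "(I :: 'a idl) \<le> J \<Longrightarrow> x \<in> elts I \<Longrightarrow> x \<in> elts J"
  by (auto simp: less_eq_idl_def)

lemma is_ideal_residual: "is_ideal {a. \<forall>c\<in>S. a * c \<in> elts (L :: 'a idl)}"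
  unfolding is_ideal_def by (auto simp: distrib_right mult.assoc elts_rules)

lemma times_commute_idl: "I * J = J * (I :: 'a idl)"
proof (rule idl_eqI)
  have "{a * b |a b. a \<in> elts I \<and> b \<in> elts J} = {a * b |a b. a \<in> elts J \<and> b \<in> elts I}"
    by (metis mult.commute)
  then show "elts (I * J) = elts (J * I)" by (simp add: elts_times ideal_prod_def)
qed

lemma elts_le_trans [trans]: "x \<in> elts I \<Longrightarrow> (I :: 'a idl) \<le> J \<Longrightarrow> x \<in> elts J"
  by (rule idl_leD)

lemma times_assoc_le: "(I * J) * L \<le> I * (J * (L :: 'a idl))"
proof (unfold elts_times_le_iff, intro ballI)
  fix x c assume x: "x \<in> elts (I * J)" and c: "c \<in> elts L"
  let ?R = "Idl {a. \<forall>c\<in>elts L. a * c \<in> elts (I * (J * L))}"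
  have R: "elts ?R = {a. \<forall>c\<in>elts L. a * c \<in> elts (I * (J * L))}"
    by (rule elts_Idl) (rule is_ideal_residual)
  have "I * J \<le> ?R"
    unfolding elts_times_le_iff R by (auto simp: mult.assoc intro!: elts_timesI)
  then show "x * c \<in> elts (I * (J * L))"
    using x c R by (auto simp: less_eq_idl_def)
qed

lemma idl_le_plus: "(I :: 'a idl) \<le> I + J" "J \<le> I + (J :: 'a idl)"
  unfolding less_eq_idl_def elts_plus
  using elts_rules(1) by (force, force)

lemma idl_plus_le: "I \<le> L \<Longrightarrow> J \<le> L \<Longrightarrow> I + J \<le> (L :: 'a idl)"
  unfolding less_eq_idl_def elts_plus by (auto intro: elts_rules)

lemma idl_plus_commute: "I + J = J + (I :: 'a idl)"
  by (rule idl_eqI) (auto simp: elts_plus, (metis add.commute)+)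

instance
proof
  fix I J L :: "'a idl"
  show antisym: "A \<le> B \<Longrightarrow> B \<le> A \<Longrightarrow> A = B" for A B :: "'a idl"
    by (simp add: less_eq_idl_def elts_inject)
  show refl: "I \<le> I" and trans: "I \<le> J \<Longrightarrow> J \<le> L \<Longrightarrow> I \<le> L"
    and "I < J \<longleftrightarrow> I \<le> J \<and> \<not> J \<le> I"
    by (auto simp: less_eq_idl_def less_idl_def)
  have tr: "A \<le> B \<Longrightarrow> B \<le> C \<Longrightarrow> A \<le> C" for A B C :: "'a idl"
    by (auto simp: less_eq_idl_def)
  show "I + J + L = I + (J + L)"
    by (rule antisym; intro idl_plus_le; meson tr idl_le_plus)
  show "I + J = J + I" by (rule idl_plus_commute)
  show "0 + I = I"
    by (rule idl_eqI) (simp add: elts_plus elts_zero)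
  have *: "(A * B) * C \<le> A * (B * C)" for A B C :: "'a idl" by (rule times_assoc_le)
  show "I * J * L = I * (J * L)"
    by (rule antisym) (metis * times_commute_idl)+
  show "I * J = J * I" by (rule times_commute_idl)
  show "1 * I = I"
  proof (rule antisym)
    show "1 * I \<le> I" by (auto simp: elts_times_le_iff elts_rules)
    show "I \<le> 1 * I"
      using elts_timesI[of 1 1 _ I] by (auto simp: less_eq_idl_def elts_one)
  qed
  show "0 * I = 0"
  proof (rule antisym)
    show "0 * I \<le> 0" by (simp add: elts_times_le_iff elts_zero)
    show "0 \<le> 0 * I" by (simp add: less_eq_idl_def elts_zero elts_rules)
  qed
  then show "I * 0 = 0" by (simp add: times_commute_idl)
  show "(I + J) * L = I * L + J * L"
  proof (rule antisym)
    show "(I + J) * L \<le> I * L + J * L"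
      using elts_timesI[of _ I _ L] elts_timesI[of _ J _ L]
      by (auto simp: elts_times_le_iff elts_plus distrib_right) blast
    have "I * L \<le> (I + J) * L" "J * L \<le> (I + J) * L"
      using idl_le_plus[of I J] idl_le_plus(2)[of J I]
      unfolding elts_times_le_iff by (auto simp: less_eq_idl_def intro!: elts_timesI)
    then show "I * L + J * L \<le> (I + J) * L" by (rule idl_plus_le)
  qed
  show "(0 :: 'a idl) \<noteq> 1"
  proof
    assume "(0 :: 'a idl) = 1"
    then have "(1 :: 'a) \<in> {0}" using elts_zero elts_one by (metis UNIV_I)
    then show False by simp
  qed
  show "I \<le> J \<longleftrightarrow> (\<exists>C. J = I + C)"
  proof
    assume "I \<le> J"
    then have "J = I + J"
      by (intro antisym idl_le_plus idl_plus_le refl) (auto simp: less_eq_idl_def)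
    then show "\<exists>C. J = I + C" ..
  qed (use idl_le_plus in auto)
qed

end

instance idl :: (comm_ring_1) ordered_comm_semiring
  by standard (auto simp: le_iff_add distrib_left)

lemma idl_le_one [simp]: "I \<le> (1 :: 'a::comm_ring_1 idl)"
  by (simp add: less_eq_idl_def elts_one)

lemma idl_plus_le_iff: "I + J \<le> (L :: 'a::comm_ring_1 idl) \<longleftrightarrow> I \<le> L \<and> J \<le> L"
  using idl_plus_le idl_le_plus order_trans by blast

lemma idl_plus_idem [simp]: "I + I = (I :: 'a::comm_ring_1 idl)"
  by (simp add: antisym idl_le_plus idl_plus_le)

lemma idl_plus_absorb: "I \<le> J \<Longrightarrow> I + J = (J :: 'a::comm_ring_1 idl)"
  by (simp add: antisym idl_le_plus idl_plus_le)

lemma idl_mult_mono: "I \<le> I' \<Longrightarrow> J \<le> J' \<Longrightarrow> I * J \<le> I' * (J' :: 'a::comm_ring_1 idl)"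
  by (rule mult_mono) auto

lemma idl_mult_le: "I * J \<le> I" "I * J \<le> (J :: 'a::comm_ring_1 idl)"
  using idl_mult_mono[of I I J 1] idl_mult_mono[of I 1 J J] by auto

lemma idl_power_mono: "I \<le> J \<Longrightarrow> I ^ n \<le> (J :: 'a::comm_ring_1 idl) ^ n"
  by (induction n) (auto intro: idl_mult_mono)

lemma idl_power_decreasing: "m \<le> n \<Longrightarrow> (I :: 'a::comm_ring_1 idl) ^ n \<le> I ^ m"
  by (metis idl_mult_le(1) le_Suc_ex power_add)

lemma elts_ideal_pow: "elts (I ^ n) = ideal_pow (elts I) n"
  by (induction n) (simp_all add: elts_one elts_times)

definition prin :: "'a::comm_ring_1 \<Rightarrow> 'a idl" where
  "prin b = Idl (range (\<lambda>r. r * b))"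

lemma elts_prin: "elts (prin b) = range (\<lambda>r. r * b)"
  unfolding prin_def
proof (rule elts_Idl, unfold is_ideal_def, intro conjI ballI allI)
  show "0 \<in> range (\<lambda>r. r * b)" by (rule image_eqI[of _ _ 0]) auto
  show "x + y \<in> range (\<lambda>r. r * b)" if "x \<in> range (\<lambda>r. r * b)" "y \<in> range (\<lambda>r. r * b)" for x y
    using that by (auto simp flip: distrib_right)
  show "r * x \<in> range (\<lambda>r. r * b)" if "x \<in> range (\<lambda>r. r * b)" for r x
    using that by (auto simp flip: mult.assoc)
qed

lemma prin_self [simp]: "b \<in> elts (prin b)"
  unfolding elts_prin by (rule image_eqI[of _ _ 1]) auto

lemma prin_le_iff: "prin b \<le> I \<longleftrightarrow> b \<in> elts I"
  using prin_self[of b] by (auto simp: less_eq_idl_def elts_prin intro: elts_rules)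

lemma elts_times_prin: "x \<in> elts (I * prin b) \<longleftrightarrow> (\<exists>r\<in>elts I. x = r * b)"
proof
  have id: "is_ideal ((\<lambda>r. r * b) ` elts I)"
    unfolding is_ideal_def
  proof (intro conjI ballI allI)
    show "0 \<in> (\<lambda>r. r * b) ` elts I"
      by (rule image_eqI[of _ _ 0]) (auto intro: elts_rules)
    show "x + y \<in> (\<lambda>r. r * b) ` elts I"
      if "x \<in> (\<lambda>r. r * b) ` elts I" "y \<in> (\<lambda>r. r * b) ` elts I" for x y
      using that by (auto simp flip: distrib_right intro: elts_rules)
    show "r * x \<in> (\<lambda>r. r * b) ` elts I" if "x \<in> (\<lambda>r. r * b) ` elts I" for r x
      using that by (auto simp flip: mult.assoc intro: elts_rules)
  qed
  have "I * prin b \<le> Idl ((\<lambda>r. r * b) ` elts I)"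
    unfolding elts_times_le_iff elts_Idl[OF id]
    by (auto simp: elts_prin simp flip: mult.assoc intro: elts_rules)
  then show "\<exists>r\<in>elts I. x = r * b" if "x \<in> elts (I * prin b)"
    using that by (auto simp: less_eq_idl_def elts_Idl[OF id])
qed (auto intro: elts_timesI)

lemma prin_mult: "prin (a * b) = prin a * prin b"
proof (rule antisym)
  show "prin (a * b) \<le> prin a * prin b" by (simp add: prin_le_iff elts_timesI)
  show "prin a * prin b \<le> prin (a * b)"
    by (auto simp: elts_times_le_iff elts_prin) (metis mult.assoc mult.left_commute rangeI)
qed

lemma prin_one: "prin 1 = 1"
  by (rule idl_eqI) (simp add: elts_prin elts_one)

lemma prin_power: "prin (a ^ n) = prin a ^ n"
  by (induction n) (simp_all add: prin_mult prin_one)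

lemma elts_plusI1: "x \<in> elts I \<Longrightarrow> x \<in> elts (I + J)"
  and elts_plusI2: "x \<in> elts J \<Longrightarrow> x \<in> elts (I + J)"
  using idl_le_plus[of I J] idl_le_plus[of J I] by (auto simp: less_eq_idl_def)

lemma elts_powerI: "x \<in> elts I \<Longrightarrow> x ^ n \<in> elts (I ^ n)"
  by (simp flip: prin_le_iff add: prin_power idl_power_mono)

definition Gen :: "'a::comm_ring_1 set \<Rightarrow> 'a idl" where "Gen S = Idl (ideal_gen S)"

lemma elts_Gen: "elts (Gen S) = ideal_gen S"
  unfolding Gen_def by (rule elts_Idl) (rule is_ideal_ideal_gen)

lemma Gen_le_iff: "Gen S \<le> I \<longleftrightarrow> S \<subseteq> elts I"
  unfolding less_eq_idl_def elts_Gen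
  using ideal_gen_least[OF is_ideal_elts] ideal_gen_superset by blast

lemma Gen_empty: "Gen {} = 0"
  using Gen_le_iff[of "{}" 0] by (simp add: antisym)

lemma Gen_insert: "Gen (insert x S) = prin x + Gen S"
proof (rule antisym)
  show "Gen (insert x S) \<le> prin x + Gen S"
    unfolding Gen_le_iff using ideal_gen_superset[of S] prin_self[of x]
    by (auto simp flip: elts_Gen intro: elts_plusI1 elts_plusI2)
  show "prin x + Gen S \<le> Gen (insert x S)"
    unfolding idl_plus_le_iff Gen_le_iff prin_le_iff elts_Gen
    using ideal_gen_superset[of "insert x S"] by auto
qed

lemma noetherian_Gen:
  assumes "noetherian_ring TYPE('a::comm_ring_1)"
  obtains F where "finite F" "(I :: 'a idl) = Gen F"
  using assms unfolding noetherian_ring_def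
  by (metis elts_Gen idl_eqI is_ideal_elts)

subsection \<open>Reductions and integral closure\<close>

lemma idl_power_plus_Suc:
  "(I + J :: 'a::comm_ring_1 idl) ^ Suc n = J ^ Suc n + I * (I + J) ^ n"
proof (induction n)
  case (Suc n)
  have *: "I * J ^ Suc n \<le> I * (I + J) ^ Suc n"
    by (intro idl_mult_mono idl_power_mono idl_le_plus order_refl)
  have "(I + J) ^ Suc (Suc n) = J * (I + J) ^ Suc n + I * (I + J) ^ Suc n"
    by (simp add: distrib_right add.commute)
  also have "J * (I + J) ^ Suc n = J ^ Suc (Suc n) + I * (J * (I + J) ^ n)"
    by (subst Suc) (simp add: distrib_left mult_ac)
  also have "I * (J * (I + J) ^ n) \<le> I * (I + J) ^ Suc n"
    by (simp add: idl_mult_mono idl_le_plus)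
  then have "J ^ Suc (Suc n) + I * (J * (I + J) ^ n) + I * (I + J) ^ Suc n =
      J ^ Suc (Suc n) + I * (I + J) ^ Suc n"
    by (simp only: add.assoc idl_plus_absorb)
  finally show ?case .
qed (simp add: add.commute)

lemma idl_power_plus_split:
  "(I + J :: 'a::comm_ring_1 idl) ^ (m + n) \<le> I ^ m * (I + J) ^ n + J ^ n * (I + J) ^ m"
proof (induction "m + n" arbitrary: m n)
  case (Suc k)
  show ?case
  proof (cases m)
    case 0
    then show ?thesis by (simp add: idl_le_plus)
  next
    case m: (Suc m')
    show ?thesis
    proof (cases n)
      case 0
      then show ?thesis by (simp add: idl_le_plus)
    next
      case n: (Suc n')
      let ?K = "I + J"
      let ?R = "I ^ m * ?K ^ n + J ^ n * ?K ^ m"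
      have k: "k = m' + n" "k = m + n'" using Suc.hyps(2) m n by auto
      have "I * ?K ^ (m' + n) \<le> I * (I ^ m' * ?K ^ n + J ^ n * ?K ^ m')"
        by (intro idl_mult_mono order_refl Suc.hyps(1) k)
      also have "\<dots> = I ^ m * ?K ^ n + J ^ n * (I * ?K ^ m')"
        using m by (simp add: distrib_left mult_ac)
      also have "\<dots> \<le> ?R"
        using m by (intro add_mono order_refl idl_mult_mono) (simp add: idl_mult_mono idl_le_plus)
      finally have A: "I * ?K ^ (m' + n) \<le> ?R" .
      have "J * ?K ^ (m + n') \<le> J * (I ^ m * ?K ^ n' + J ^ n' * ?K ^ m)"
        by (intro idl_mult_mono order_refl Suc.hyps(1) k)
      also have "\<dots> = I ^ m * (J * ?K ^ n') + J ^ n * ?K ^ m"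
        using n by (simp add: distrib_left mult_ac)
      also have "\<dots> \<le> ?R"
        using n by (intro add_mono order_refl idl_mult_mono) (simp add: idl_mult_mono idl_le_plus)
      finally have B: "J * ?K ^ (m + n') \<le> ?R" .
      have "?K ^ (m + n) = I * ?K ^ (m' + n) + J * ?K ^ (m + n')"
        using m n by (simp add: distrib_right)
      then show ?thesis using A B by (simp add: idl_plus_le)
    qed
  qed
qed simp

definition red :: "'a::comm_ring_1 idl \<Rightarrow> 'a idl \<Rightarrow> bool" where
  "red J K \<longleftrightarrow> J \<le> K \<and> (\<exists>n. K ^ Suc n \<le> J * K ^ n)"

lemma red_refl: "red J J"
  unfolding red_def by (auto intro!: exI[of _ 0])

lemma red_power:
  assumes "K ^ Suc n \<le> J * (K :: 'a::comm_ring_1 idl) ^ n"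
  shows "K ^ (s + n) \<le> J ^ s * K ^ n"
proof (induction s)
  case (Suc s)
  have "K ^ (Suc s + n) \<le> K * (J ^ s * K ^ n)"
    using Suc by (simp add: idl_mult_mono)
  also have "\<dots> = J ^ s * K ^ Suc n" by (simp add: mult_ac)
  also have "\<dots> \<le> J ^ s * (J * K ^ n)" by (intro idl_mult_mono assms order_refl)
  finally show ?case by (simp add: mult_ac)
qed simp

lemma red_powerE:
  assumes "red J K"
  obtains n where "\<forall>s. K ^ (s + n) \<le> J ^ s * K ^ n"
proof -
  obtain n where n: "K ^ Suc n \<le> J * K ^ n" using assms red_def by blast
  show ?thesis by (rule that) (blast intro: red_power[OF n])
qed

lemma red_trans:
  assumes "red J' J" "red J K"
  shows "red J' K"
proof -
  obtain n where n: "J ^ Suc n \<le> J' * J ^ n" using assms(1) red_def by blast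
  obtain r where r: "\<forall>s. K ^ (s + r) \<le> J ^ s * K ^ r" using assms(2) by (rule red_powerE)
  have "K ^ (Suc n + r) \<le> J ^ Suc n * K ^ r" using r by blast
  also have "\<dots> \<le> (J' * K ^ n) * K ^ r"
    using assms(2) unfolding red_def
    by (intro idl_mult_mono order_refl order_trans[OF n] idl_power_mono) auto
  finally have "K ^ Suc (n + r) \<le> J' * K ^ (n + r)" by (simp add: power_add mult_ac)
  then show ?thesis using assms unfolding red_def by (meson order_trans)
qed

lemma red_plus:
  assumes "red J K" "red J L"
  shows "red J (K + L)"
proof -
  obtain n where n: "K ^ Suc n \<le> J * K ^ n" using assms(1) red_def by blast
  obtain p where p: "L ^ Suc p \<le> J * L ^ p" using assms(2) red_def by blast
  let ?M = "K + L"
  have "?M ^ (Suc n + Suc p) \<le> K ^ Suc n * ?M ^ Suc p + L ^ Suc p * ?M ^ Suc n"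
    by (rule idl_power_plus_split)
  also have "\<dots> \<le> (J * ?M ^ n) * ?M ^ Suc p + (J * ?M ^ p) * ?M ^ Suc n"
    by (intro add_mono idl_mult_mono order_refl order_trans[OF n] order_trans[OF p]
        idl_power_mono idl_le_plus)
  also have "\<dots> = J * ?M ^ Suc (n + p)"
    by (simp add: power_add mult_ac)
  finally have "?M ^ Suc (Suc (n + p)) \<le> J * ?M ^ Suc (n + p)" by simp
  then show ?thesis
    using assms idl_le_plus(1)[of K L] unfolding red_def by (meson order_trans)
qed

lemma red_plus_prin_iff:
  "red J (J + prin b) \<longleftrightarrow> (\<exists>n. b ^ Suc n \<in> elts (J * (J + prin b) ^ n))"
proof -
  have "(J + prin b) ^ Suc n \<le> J * (J + prin b) ^ n \<longleftrightarrow> b ^ Suc n \<in> elts (J * (J + prin b) ^ n)" for n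
    by (simp only: idl_power_plus_Suc idl_plus_le_iff prin_le_iff order_refl simp_thms flip: prin_power)
  then show ?thesis by (auto simp: red_def idl_le_plus)
qed

lemma elts_power_plus_prin:
  assumes "x \<in> elts (L * (J + prin b) ^ n)"
  shows "\<exists>a. (\<forall>i\<le>n. a i \<in> elts (L * J ^ i)) \<and> x = (\<Sum>i\<le>n. a i * b ^ (n - i))"
  using assms
proof (induction n arbitrary: x L)
  case 0
  then show ?case by (intro exI[of _ "\<lambda>_. x"]) auto
next
  case (Suc n)
  have "L * (J + prin b) ^ Suc n = (L * J) * (J + prin b) ^ n + (L * (J + prin b) ^ n) * prin b"
    by (simp add: distrib_right distrib_left mult_ac)
  then obtain y z where yz: "x = y + z" "y \<in> elts ((L * J) * (J + prin b) ^ n)"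
      "z \<in> elts ((L * (J + prin b) ^ n) * prin b)"
    using Suc.prems by (auto simp: elts_plus)
  obtain r where r: "r \<in> elts (L * (J + prin b) ^ n)" "z = r * b"
    using yz(3) by (auto simp: elts_times_prin)
  obtain a where a: "\<And>i. i \<le> n \<Longrightarrow> a i \<in> elts ((L * J) * J ^ i)" "y = (\<Sum>i\<le>n. a i * b ^ (n - i))"
    using Suc.IH[OF yz(2)] by blast
  obtain c where c: "\<And>i. i \<le> n \<Longrightarrow> c i \<in> elts (L * J ^ i)" "r = (\<Sum>i\<le>n. c i * b ^ (n - i))"
    using Suc.IH[OF r(1)] by blast
  define a' where "a' i = (if i = 0 then 0 else a (i - 1))" for i
  define c' where "c' i = (if i \<le> n then c i else 0)" for i
  have "a' i + c' i \<in> elts (L * J ^ i)" if "i \<le> Suc n" for i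
  proof (rule elts_rules(2))
    show "a' i \<in> elts (L * J ^ i)"
      using a(1)[of "i - 1"] that by (cases i) (auto simp: a'_def elts_rules mult.assoc)
    show "c' i \<in> elts (L * J ^ i)"
      using c(1)[of i] by (auto simp: c'_def elts_rules)
  qed
  moreover have "y = (\<Sum>i\<le>Suc n. a' i * b ^ (Suc n - i))"
    by (subst sum.atMost_Suc_shift) (simp add: a'_def a)
  moreover have "z = (\<Sum>i\<le>Suc n. c' i * b ^ (Suc n - i))"
    by (simp add: c'_def r c sum_distrib_right mult.assoc Suc_diff_le flip: power_Suc2)
  ultimately show ?case
    using yz(1) by (intro exI[of _ "\<lambda>i. a' i + c' i"]) (auto simp: distrib_right sum.distrib)
qed

lemma elts_times_power_plus:
  assumes "a \<in> elts (J ^ i)" "b \<in> elts K" "J \<le> K" "i \<le> n"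
  shows "a * b ^ (n - i) \<in> elts (K ^ n)"
proof -
  have "a * b ^ (n - i) \<in> elts (K ^ i * K ^ (n - i))"
    using assms idl_power_mono[OF assms(3), of i]
    by (intro elts_timesI elts_powerI) (auto simp: less_eq_idl_def)
  then show ?thesis using assms by (simp flip: power_add)
qed

lemma int_closure_iff_red: "b \<in> int_closure (elts J) \<longleftrightarrow> red J (J + prin b)"
proof
  assume "b \<in> int_closure (elts J)"
  then obtain n a where n: "n \<ge> 1" and a: "\<And>i. i \<in> {1..n} \<Longrightarrow> a i \<in> elts (J ^ i)"
    and eq: "b ^ n + (\<Sum>i=1..n. a i * b ^ (n - i)) = 0"
    unfolding int_closure_def elts_ideal_pow by blast
  obtain k where k: "n = Suc k" using n by (cases n) auto
  have "a i * b ^ (n - i) \<in> elts (J * (J + prin b) ^ k)" if i: "i \<in> {1..n}" for i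
  proof -
    obtain i' where i': "i = Suc i'" using i by (cases i) auto
    have "a i * b ^ (n - i) \<in> elts (J ^ i * prin b ^ (n - i))"
      by (intro elts_timesI a i elts_powerI prin_self)
    also have "J ^ i * prin b ^ (n - i) \<le> (J * (J + prin b) ^ i') * (J + prin b) ^ (n - i)"
      unfolding i' power_Suc by (intro idl_mult_mono idl_power_mono idl_le_plus order_refl)
    also have "\<dots> = J * (J + prin b) ^ k"
      using i unfolding k i' by (simp add: mult.assoc flip: power_add)
    finally show ?thesis .
  qed
  then have "(\<Sum>i=1..n. a i * b ^ (n - i)) \<in> elts (J * (J + prin b) ^ k)"
    by (intro elts_sum) auto
  moreover have "b ^ Suc k = - (\<Sum>i=1..n. a i * b ^ (n - i))"
    using eq unfolding k eq_neg_iff_add_eq_0 .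
  ultimately show "red J (J + prin b)"
    unfolding red_plus_prin_iff by (metis elts_uminus)
next
  assume "red J (J + prin b)"
  then obtain n where "b ^ Suc n \<in> elts (J * (J + prin b) ^ n)"
    unfolding red_plus_prin_iff ..
  then obtain a where a: "\<And>i. i \<le> n \<Longrightarrow> a i \<in> elts (J * J ^ i)"
      and eq: "b ^ Suc n = (\<Sum>i\<le>n. a i * b ^ (n - i))"
    using elts_power_plus_prin by blast
  show "b \<in> int_closure (elts J)"
    unfolding int_closure_def mem_Collect_eq
  proof (intro exI conjI ballI)
    show "1 \<le> Suc n" by simp
    show "- a (i - 1) \<in> ideal_pow (elts J) i" if "i \<in> {1..Suc n}" for i
      using a[of "i - 1"] that
      by (cases i) (auto intro!: elts_uminus simp flip: elts_ideal_pow elts_times)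
    have "(\<Sum>i=1..Suc n. - a (i - 1) * b ^ (Suc n - i)) = (\<Sum>i\<le>n. - a i * b ^ (n - i))"
      by (rule sum.reindex_bij_witness[of _ Suc "\<lambda>i. i - 1"]) auto
    then show "b ^ Suc n + (\<Sum>i=1..Suc n. - a (i - 1) * b ^ (Suc n - i)) = 0"
      unfolding eq by (simp add: sum_negf)
  qed
qed

lemma monic_mult:
  fixes b :: "'a::comm_ring_1"
  assumes "f - b ^ Suc r \<in> elts (J * K ^ r)" "g - b ^ Suc s \<in> elts (J * K ^ s)"
    "J \<le> K" "b \<in> elts K"
  shows "f * g - b ^ Suc (Suc (r + s)) \<in> elts (J * K ^ Suc (r + s))"
proof -
  define e e' where "e = f - b ^ Suc r" and "e' = g - b ^ Suc s"
  have b: "b ^ Suc n \<in> elts (K ^ Suc n)" for n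
    using assms(4) by (rule elts_powerI)
  have "f * g - b ^ Suc (Suc (r + s)) = e * b ^ Suc s + e' * b ^ Suc r + e * e'"
    unfolding e_def e'_def by (simp add: algebra_simps power_add)
  moreover have "e * b ^ Suc s \<in> elts (J * K ^ r * K ^ Suc s)"
    and "e' * b ^ Suc r \<in> elts (J * K ^ s * K ^ Suc r)"
    unfolding e_def e'_def by (intro elts_timesI assms b)+
  moreover have "e * e' \<in> elts (J * K ^ Suc (r + s))"
  proof -
    have "e * e' \<in> elts (J * K ^ r * (J * K ^ s))"
      unfolding e_def e'_def by (intro elts_timesI assms)
    also have "J * K ^ r * (J * K ^ s) \<le> J * K ^ r * (K * K ^ s)"
      by (intro idl_mult_mono assms order_refl)
    finally show ?thesis by (simp add: power_add mult_ac)
  qed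
  ultimately show ?thesis
    by (simp add: power_add mult_ac elts_rules)
qed

lemma annihilates_Gen:
  assumes "\<And>s. s \<in> S \<Longrightarrow> f * s = 0" "x \<in> elts (Gen S)"
  shows "f * x = 0"
proof -
  have "is_ideal {y. f * y = 0}"
    by (auto simp: is_ideal_def distrib_left mult.left_commute[of f])
  then show ?thesis using assms ideal_gen_least[of "{y. f * y = 0}" S] by (auto simp: elts_Gen)
qed

text \<open>The Cayley-Hamilton argument, by elimination of one generator at a time.\<close>
lemma monic_annihilator:
  fixes b :: "'a::comm_ring_1"
  assumes "finite S" and "J \<le> K" "b \<in> elts K"
    and "f - b ^ Suc r \<in> elts (J * K ^ r)"
    and "\<And>s. s \<in> S \<Longrightarrow> f * s \<in> elts (J * K ^ r * Gen S)"
  shows "\<exists>r' f'. f' - b ^ Suc r' \<in> elts (J * K ^ r') \<and> (\<forall>s\<in>S. f' * s = 0)"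
  using assms(1,4,5)
proof (induction S arbitrary: f r rule: finite_induct)
  case (insert x S)
  let ?C = "J * K ^ r"
  have split: "\<exists>c\<in>elts ?C. \<exists>g\<in>elts (?C * Gen S). f * s = c * x + g" if "s \<in> insert x S" for s
  proof -
    have "f * s \<in> elts (?C * prin x + ?C * Gen S)"
      using insert.prems(2)[OF that] by (simp add: Gen_insert distrib_left)
    then show ?thesis by (auto simp: elts_plus elts_times_prin)
  qed
  obtain c g where c: "c \<in> elts ?C" and g: "g \<in> elts (?C * Gen S)" and fx: "f * x = c * x + g"
    using split[of x] by blast
  define h where "h = f - c"
  have hx: "h * x = g" unfolding h_def using fx by (simp add: algebra_simps)
  have h: "h - b ^ Suc r \<in> elts ?C"
    using elts_diff[OF insert.prems(1) c] by (simp add: h_def algebra_simps)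
  have "?C \<le> K ^ Suc r" using assms(2) by (simp add: idl_mult_mono)
  then have hK: "h \<in> elts (K ^ Suc r)"
    using elts_rules(2)[OF idl_leD[OF _ h] elts_powerI[OF assms(3), of "Suc r"]] by simp
  have hfs: "h * f * s \<in> elts (J * K ^ Suc (r + r) * Gen S)" if s: "s \<in> S" for s
  proof -
    obtain c' g' where c': "c' \<in> elts ?C" and g': "g' \<in> elts (?C * Gen S)" and fs: "f * s = c' * x + g'"
      using split[of s] s by blast
    have "h * f * s = c' * (h * x) + h * g'"
      unfolding mult.assoc fs by (simp add: algebra_simps)
    also have "\<dots> = c' * g + h * g'" by (simp only: hx)
    also have "\<dots> \<in> elts (K ^ Suc r * (?C * Gen S))"
      using c' \<open>?C \<le> K ^ Suc r\<close>
      by (intro elts_rules(2) elts_timesI g g' hK) (rule idl_leD)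
    finally show ?thesis by (simp add: power_add mult_ac)
  qed
  obtain r' f' where f': "f' - b ^ Suc r' \<in> elts (J * K ^ r')" "\<And>s. s \<in> S \<Longrightarrow> f' * s = 0"
    using insert.IH[OF monic_mult[OF h insert.prems(1) assms(2,3)] hfs] by blast
  have "f' * g = 0"
    using g idl_mult_le(2) by (intro annihilates_Gen[OF f'(2)]) (auto simp: less_eq_idl_def)
  then have "f' * h * x = 0" by (simp add: mult.assoc hx)
  moreover have "f' * h * s = 0" if "s \<in> S" for s
    using f'(2)[OF that] by (simp add: mult.assoc mult.left_commute[of f' h])
  ultimately have "\<forall>s\<in>insert x S. (f' * h) * s = 0" by blast
  then show ?case
    using monic_mult[OF f'(1) h assms(2,3)] by blast
qed blast

lemma red_imp_integral:
  assumes noeth: "noetherian_ring TYPE('a::comm_ring_1)"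
    and "red J (K :: 'a idl)" and b: "b \<in> elts K"
  shows "red J (J + prin b)"
proof -
  obtain n where n: "K ^ Suc n \<le> J * K ^ n" using assms(2) red_def by blast
  obtain S where S: "finite S" "K ^ n = Gen S" using noeth by (rule noetherian_Gen)
  let ?L = "J + prin b"
  have "b * s \<in> elts (J * ?L ^ 0 * Gen S)" if "s \<in> S" for s
  proof -
    have "s \<in> elts (K ^ n)" using that ideal_gen_superset by (auto simp: S elts_Gen)
    then have "b * s \<in> elts (K ^ Suc n)" using b by (auto intro: elts_timesI)
    then show ?thesis using n by (auto simp: S less_eq_idl_def)
  qed
  moreover have "J \<le> ?L" "b \<in> elts ?L" by (auto simp: idl_le_plus intro: elts_plusI2)
  moreover have "b - b ^ Suc 0 \<in> elts (J * ?L ^ 0)" by (simp add: elts_rules)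
  ultimately obtain r f where f: "f - b ^ Suc r \<in> elts (J * ?L ^ r)" "\<And>s. s \<in> S \<Longrightarrow> f * s = 0"
    using monic_annihilator[OF S(1)] by blast
  have "f * b ^ n = 0"
    using f(2) elts_powerI[OF b, of n] unfolding S(2) by (rule annihilates_Gen)
  then have "b ^ Suc (r + n) = - ((f - b ^ Suc r) * b ^ n)"
    by (simp add: algebra_simps power_add)
  moreover have "(f - b ^ Suc r) * b ^ n \<in> elts (J * ?L ^ r * ?L ^ n)"
    by (intro elts_timesI f elts_powerI elts_plusI2 prin_self)
  ultimately have "b ^ Suc (r + n) \<in> elts (J * ?L ^ (r + n))"
    using elts_uminus by (metis mult.assoc power_add)
  then show ?thesis unfolding red_plus_prin_iff by blast
qed

lemma integral_imp_red:
  assumes noeth: "noetherian_ring TYPE('a::comm_ring_1)"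
    and "J \<le> (K :: 'a idl)" and int: "elts K \<subseteq> int_closure (elts J)"
  shows "red J K"
proof -
  obtain S where S: "finite S" "K = Gen S" using noeth by (rule noetherian_Gen)
  have "red J (J + Gen S)" if "finite S" "S \<subseteq> int_closure (elts J)" for S
    using that
  proof (induction S rule: finite_induct)
    case (insert x S)
    then have "red J ((J + Gen S) + (J + prin x))"
      by (intro red_plus[of J "J + Gen S"]) (auto simp: int_closure_iff_red)
    moreover have "(J + Gen S) + (J + prin x) = (J + J) + (prin x + Gen S)"
      by (simp only: add_ac)
    ultimately show ?case by (simp add: Gen_insert)
  qed (simp add: Gen_empty red_refl)
  moreover have "S \<subseteq> int_closure (elts J)"
    using int ideal_gen_superset by (auto simp: S elts_Gen)
  ultimately show ?thesis using assms(2) S by (metis idl_plus_absorb)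
qed

lemma int_closure_mono:
  assumes "I \<le> J"
  shows "int_closure (elts I) \<subseteq> int_closure (elts J)"
proof -
  have "ideal_pow (elts I) i \<subseteq> ideal_pow (elts J) i" for i
    using idl_power_mono[OF assms] by (simp add: less_eq_idl_def elts_ideal_pow)
  then have "(\<forall>i\<in>S. a i \<in> ideal_pow (elts I) i) \<Longrightarrow> (\<forall>i\<in>S. a i \<in> ideal_pow (elts J) i)" for S a
    by blast
  then show ?thesis unfolding int_closure_def by fast
qed

lemma subset_int_closure: "elts I \<subseteq> int_closure (elts I)"
proof
  fix x assume "x \<in> elts I"
  then have "I + prin x = I"
    using idl_plus_absorb[of "prin x" I] by (simp add: prin_le_iff add.commute)
  then show "x \<in> int_closure (elts I)" by (simp add: int_closure_iff_red red_refl)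
qed

lemma is_reduction_iff_red:
  assumes noeth: "noetherian_ring TYPE('a::comm_ring_1)"
  shows "is_reduction (elts J) (elts (I :: 'a idl)) \<longleftrightarrow> red J I"
proof
  assume "is_reduction (elts J) (elts I)"
  then have "J \<le> I" "elts I \<subseteq> int_closure (elts J)"
    using subset_int_closure unfolding is_reduction_def by (auto simp: less_eq_idl_def)
  then show "red J I" by (rule integral_imp_red[OF noeth])
next
  assume red: "red J I"
  then have "J \<le> I" by (simp add: red_def)
  moreover have "b \<in> int_closure (elts J)" if "b \<in> int_closure (elts I)" for b
  proof -
    have "red J (I + prin b)" using red that int_closure_iff_red red_trans by blast
    then show ?thesis
      unfolding int_closure_iff_red by (rule red_imp_integral[OF noeth]) (auto intro: elts_plusI2)
  qed
  ultimately show "is_reduction (elts J) (elts I)"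
    using int_closure_mono[of J I] unfolding is_reduction_def by (auto simp: less_eq_idl_def)
qed

lemma local_unit:
  assumes "local_ring_max (elts M)" "x \<notin> elts M"
  obtains y where "y * x = 1"
proof -
  have "\<not> elts (prin x) \<subseteq> elts M" using assms(2) prin_self by blast
  then have "elts (prin x) = UNIV"
    using assms(1) is_ideal_elts unfolding local_ring_max_def by blast
  then have "1 \<in> range (\<lambda>r. r * x)" by (simp add: elts_prin)
  then show ?thesis using that by (metis rangeE)
qed

lemma local_one_minus:
  assumes "local_ring_max (elts M)" "x \<in> elts M"
  shows "1 - x \<notin> elts M"
proof
  assume "1 - x \<in> elts M"
  then have "1 \<in> elts M" using elts_rules(2)[OF _ assms(2)] by force
  then have "r \<in> elts M" for r using elts_rules(3)[of 1 M r] by simp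
  then show False using assms(1) unfolding local_ring_max_def by blast
qed

lemma nakayama:
  assumes noeth: "noetherian_ring TYPE('a::comm_ring_1)"
    and loc: "local_ring_max (elts M)"
    and N: "N \<le> L + M * (N :: 'a idl)"
  shows "N \<le> L"
proof -
  have "N \<le> L" if "finite S" "S \<subseteq> elts N" "N \<le> L + Gen S" for S
    using that
  proof (induction S rule: finite_induct)
    case (insert x S)
    have "N \<le> L + M * (L + Gen (insert x S))"
      by (rule order_trans[OF N]) (intro add_mono idl_mult_mono order_refl insert.prems)
    also have "\<dots> = L + M * L + M * Gen S + M * prin x"
      by (simp add: Gen_insert distrib_left add_ac)
    also have "\<dots> \<le> L + L + Gen S + M * prin x"
      by (intro add_mono order_refl idl_mult_le)
    finally have N': "N \<le> L + Gen S + M * prin x" by simp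
    then have "x \<in> elts (L + Gen S + M * prin x)"
      using insert.prems by (auto simp: less_eq_idl_def)
    then obtain y r where y: "y \<in> elts (L + Gen S)" and r: "r \<in> elts M" and x: "x = y + r * x"
      by (auto simp: elts_plus[of _ "M * prin x"] elts_times_prin)
    obtain v where v: "v * (1 - r) = 1"
      using local_unit[OF loc local_one_minus[OF loc r]] by blast
    have "x = v * ((1 - r) * x)" using v by (simp flip: mult.assoc)
    also have "(1 - r) * x = y" using x by (simp add: algebra_simps)
    finally have "x \<in> elts (L + Gen S)" using y by (metis elts_rules(3))
    then have "M * prin x \<le> L + Gen S"
      using order_trans[OF idl_mult_le(2)[of M "prin x"]] by (simp add: prin_le_iff)
    then have "N \<le> L + Gen S"
      using N' by (simp add: idl_plus_absorb add.commute[of "L + Gen S"])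
    then show ?case using insert by simp
  qed (simp add: Gen_empty)
  moreover obtain S where "finite S" "N = Gen S" using noeth by (rule noetherian_Gen)
  ultimately show ?thesis
    using ideal_gen_superset idl_le_plus(2) by (metis elts_Gen)
qed

subsection \<open>The asymptotic order\<close>

lemma ord_ideal_ge_iff: "enat k \<le> ord_ideal (elts I) x \<longleftrightarrow> x \<in> elts (I ^ k)"
proof (cases "\<forall>n. x \<in> elts (I ^ n)")
  case True
  then show ?thesis by (simp add: ord_ideal_def flip: elts_ideal_pow)
next
  case False
  then obtain N where N: "x \<notin> elts (I ^ N)" by blast
  have mono: "x \<in> elts (I ^ j)" if "x \<in> elts (I ^ k)" "j \<le> k" for j k
    using idl_power_decreasing[OF that(2)] that(1) by (rule idl_leD)
  let ?P = "\<lambda>n. x \<in> elts (I ^ n)"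
  have bd: "?P n \<Longrightarrow> n \<le> N" for n using mono[of n N] N by (meson nat_le_linear)
  have "?P 0" by (simp add: elts_one)
  then have "?P (GREATEST n. ?P n)" using bd by (rule GreatestI_nat)
  moreover have "n \<le> (GREATEST n. ?P n)" if "?P n" for n
    using that bd by (rule Greatest_le_nat)
  moreover have "ord_ideal (elts I) x = enat (GREATEST n. ?P n)"
    using False unfolding ord_ideal_def elts_ideal_pow[symmetric] by simp
  ultimately show ?thesis
    using mono by (metis enat_ord_simps(1))
qed

text \<open>Existence of the limit is Fekete's lemma for the superadditive order function.\<close>
lemma vbar_eq_SUP:
  "vbar (elts I) a = (SUP n\<in>{1..}. ereal_of_enat (ord_ideal (elts I) (a ^ n)) / ereal (real n))"
  (is "_ = ?S")
proof -
  define s where "s n = ereal_of_enat (ord_ideal (elts I) (a ^ n)) / ereal (real n)" for n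
  have le: "ereal (real k / real n) \<le> s n" if "a ^ n \<in> elts (I ^ k)" "n \<ge> 1" for k n
  proof -
    have "ereal (real k) \<le> ereal_of_enat (ord_ideal (elts I) (a ^ n))"
      using that ord_ideal_ge_iff[of k I "a ^ n"]
      by (metis ereal_of_enat_le_iff ereal_of_enat_simps(1))
    then have "ereal (real k) / ereal (real n) \<le> s n"
      unfolding s_def using that by (intro ereal_divide_right_mono) auto
    then show ?thesis using that by simp
  qed
  have "s \<longlonglongrightarrow> ?S"
  proof (rule order_tendstoI)
    fix y assume "y < ?S"
    then obtain p where p: "p \<ge> 1" "y < s p"
      unfolding less_SUP_iff s_def by auto
    have "\<exists>k. a ^ p \<in> elts (I ^ k) \<and> y < ereal (real k / real p)"
    proof (cases "ord_ideal (elts I) (a ^ p)")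
      case (enat k)
      then have "a ^ p \<in> elts (I ^ k)" by (simp flip: ord_ideal_ge_iff)
      moreover have "s p = ereal (real k / real p)" using enat p by (simp add: s_def)
      ultimately show ?thesis using p by auto
    next
      case infinity
      then have all: "a ^ p \<in> elts (I ^ k)" for k by (simp flip: ord_ideal_ge_iff)
      obtain k where "y < ereal (real k / real p)"
      proof (cases y)
        case (real r)
        obtain k :: nat where "r * real p < real k" using reals_Archimedean2 by blast
        then show ?thesis using that p real by (auto simp: field_simps)
      next
        case PInf
        then show ?thesis using p by simp
      next
        case MInf
        then show ?thesis using that by simp
      qed
      then show ?thesis using all by blast
    qed
    then obtain k where k: "a ^ p \<in> elts (I ^ k)" "y < ereal (real k / real p)" by blast
    have lower: "ereal (real k / real p - real k / real n) \<le> s n" if "n \<ge> 1" for n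
    proof -
      have "a ^ n = a ^ (n mod p) * (a ^ p) ^ (n div p)"
        by (simp flip: power_mult power_add)
      also have "\<dots> \<in> elts ((I ^ k) ^ (n div p))"
        by (intro elts_rules(3) elts_powerI k)
      finally have "ereal (real (k * (n div p)) / real n) \<le> s n"
        using that by (intro le) (auto simp flip: power_mult)
      moreover have "real k / real p - real k / real n \<le> real (k * (n div p)) / real n"
      proof -
        have "n < p * (n div p) + p"
          using p dividend_less_times_div[of p n] by simp
        then have "real n \<le> real p * (real (n div p) + 1)"
          by (metis (no_types, opaque_lifting) less_imp_le distrib_left mult.right_neutral of_nat_add of_nat_le_iff of_nat_mult)
        then have "real k * real n \<le> real k * (real p * (real (n div p) + 1))"
          by (rule mult_left_mono) simp
        then have "real k / real p \<le> (real k * real (n div p) + real k) / real n"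
          using p that by (simp add: pos_divide_le_eq pos_le_divide_eq algebra_simps)
        then show ?thesis by (simp add: add_divide_distrib)
      qed
      ultimately show ?thesis by (meson ereal_less_eq(3) order_trans)
    qed
    have "(\<lambda>n. real k / real p - real k / real n) \<longlonglongrightarrow> real k / real p - 0"
      by (intro tendsto_intros lim_const_over_n)
    then have "(\<lambda>n. ereal (real k / real p - real k / real n)) \<longlonglongrightarrow> ereal (real k / real p)"
      by simp
    then have "\<forall>\<^sub>F n in sequentially. y < ereal (real k / real p - real k / real n)"
      using k(2) by (rule order_tendstoD)
    then show "\<forall>\<^sub>F n in sequentially. y < s n"
      using eventually_ge_at_top[of 1] by eventually_elim (use lower less_le_trans in blast)
  next
    fix y assume "?S < y"
    then have "s n < y" if "n \<ge> 1" for n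
      using that unfolding s_def by (intro le_less_trans[OF _ \<open>?S < y\<close>] SUP_upper) auto
    then show "\<forall>\<^sub>F n in sequentially. s n < y"
      using eventually_sequentially by blast
  qed
  then show ?thesis unfolding vbar_def s_def by (rule limI)
qed

lemma I_gt_iff: "a \<in> I_gt (elts I) \<longleftrightarrow> (\<exists>n\<ge>1. a ^ n \<in> elts (I ^ Suc n))"
proof -
  have "1 < ereal_of_enat (ord_ideal (elts I) (a ^ n)) / ereal (real n) \<longleftrightarrow> a ^ n \<in> elts (I ^ Suc n)"
    if n: "n \<ge> 1" for n
  proof (cases "ord_ideal (elts I) (a ^ n)")
    case (enat k)
    have "1 < ereal_of_enat (enat k) / ereal (real n) \<longleftrightarrow> enat (Suc n) \<le> enat k"
      using n by (auto simp: field_simps)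
    then show ?thesis using enat ord_ideal_ge_iff by metis
  next
    case infinity
    then show ?thesis using n ord_ideal_ge_iff[of "Suc n" I "a ^ n"] by simp
  qed
  then show ?thesis
    unfolding I_gt_def vbar_eq_SUP mem_Collect_eq less_SUP_iff by auto
qed

lemma I_gt_eventually:
  assumes "a \<in> I_gt (elts I)"
  shows "\<exists>N. \<forall>k\<ge>N. a ^ k \<in> elts (I ^ (k + r))"
proof -
  obtain n where n: "n \<ge> 1" "a ^ n \<in> elts (I ^ Suc n)" using assms I_gt_iff by blast
  have "a ^ k \<in> elts (I ^ (k + r))" if k: "k \<ge> n * (r + n)" for k
  proof -
    have "a ^ k = a ^ (k mod n) * (a ^ n) ^ (k div n)"
      by (simp flip: power_mult power_add)
    also have "\<dots> \<in> elts ((I ^ Suc n) ^ (k div n))"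
      by (intro elts_rules(3) elts_powerI n)
    also have "(I ^ Suc n) ^ (k div n) \<le> I ^ (k + r)"
    proof -
      have "r + n \<le> k div n" using k n by (simp add: less_eq_div_iff_mult_less_eq mult.commute)
      moreover have "k mod n < n" using n by simp
      ultimately have "k + r \<le> n * (k div n) + k div n"
        using mult_div_mod_eq[of n k] by linarith
      then show ?thesis unfolding power_mult[symmetric] by (intro idl_power_decreasing) simp
    qed
    finally show ?thesis .
  qed
  then show ?thesis by blast
qed

lemma is_ideal_I_gt: "is_ideal (I_gt (elts I))"
  unfolding is_ideal_def
proof (intro conjI ballI allI)
  show "0 \<in> I_gt (elts I)" unfolding I_gt_iff by (intro exI[of _ 1]) (simp add: elts_rules)
next
  fix r x assume "x \<in> I_gt (elts I)"
  then show "r * x \<in> I_gt (elts I)"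
    unfolding I_gt_iff power_mult_distrib by (blast intro: elts_rules(3))
next
  fix a b assume a: "a \<in> I_gt (elts I)" and b: "b \<in> I_gt (elts I)"
  have "\<exists>M. \<forall>k. x ^ k \<in> elts (I ^ (k - M))" if x: "x \<in> I_gt (elts I)" for x
  proof -
    obtain M where M: "\<And>k. k \<ge> M \<Longrightarrow> x ^ k \<in> elts (I ^ (k + 0))"
      using I_gt_eventually[OF x] by blast
    have "x ^ k \<in> elts (I ^ (k - M))" for k
    proof (cases "k \<ge> M")
      case True
      then show ?thesis using idl_leD[OF idl_power_decreasing M[OF True]] by simp
    qed (simp add: elts_one)
    then show ?thesis by blast
  qed
  then obtain M1 M2 where M: "\<And>k. a ^ k \<in> elts (I ^ (k - M1))" "\<And>k. b ^ k \<in> elts (I ^ (k - M2))"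
    using a b by meson
  obtain N1 where N1: "\<And>k. k \<ge> N1 \<Longrightarrow> a ^ k \<in> elts (I ^ (k + Suc M2))"
    using I_gt_eventually[OF a] by blast
  obtain N2 where N2: "\<And>k. k \<ge> N2 \<Longrightarrow> b ^ k \<in> elts (I ^ (k + Suc M1))"
    using I_gt_eventually[OF b] by blast
  define N where "N = Suc (N1 + N2)"
  have "a ^ i * b ^ (N - i) \<in> elts (I ^ Suc N)" if i: "i \<le> N" for i
  proof (cases "i \<ge> N1")
    case True
    then have "a ^ i * b ^ (N - i) \<in> elts (I ^ (i + Suc M2) * I ^ (N - i - M2))"
      by (intro elts_timesI N1 M)
    also have "I ^ (i + Suc M2) * I ^ (N - i - M2) \<le> I ^ Suc N"
      unfolding power_add[symmetric] using i by (intro idl_power_decreasing) linarith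
    finally show ?thesis .
  next
    case False
    then have "a ^ i * b ^ (N - i) \<in> elts (I ^ (i - M1) * I ^ (N - i + Suc M1))"
      by (intro elts_timesI N2 M) (simp add: N_def)
    also have "I ^ (i - M1) * I ^ (N - i + Suc M1) \<le> I ^ Suc N"
      unfolding power_add[symmetric] using i by (intro idl_power_decreasing) linarith
    finally show ?thesis .
  qed
  then have "(a + b) ^ N \<in> elts (I ^ Suc N)"
    unfolding binomial_ring by (intro elts_sum) (auto simp: mult.assoc intro: elts_rules(3))
  then show "a + b \<in> I_gt (elts I)" unfolding I_gt_iff by (intro exI[of _ N]) (auto simp: N_def)
qed

lemma ideal_sum_I_gt_iff:
  "x \<in> ideal_sum (elts J) (I_gt (elts I)) \<longleftrightarrow> (\<exists>j\<in>elts J. \<exists>c\<in>I_gt (elts I). x = j + c)"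
proof -
  have L: "elts (Idl (I_gt (elts I))) = I_gt (elts I)" by (rule elts_Idl) (rule is_ideal_I_gt)
  have "ideal_sum (elts J) (I_gt (elts I)) = elts (Gen (elts J \<union> elts (Idl (I_gt (elts I)))))"
    by (simp add: ideal_sum_def elts_Gen L)
  also have "Gen (elts J \<union> elts (Idl (I_gt (elts I)))) = J + Idl (I_gt (elts I))"
  proof (rule antisym)
    show "Gen (elts J \<union> elts (Idl (I_gt (elts I)))) \<le> J + Idl (I_gt (elts I))"
      unfolding Gen_le_iff by (auto intro: elts_plusI1 elts_plusI2)
    show "J + Idl (I_gt (elts I)) \<le> Gen (elts J \<union> elts (Idl (I_gt (elts I))))"
      using ideal_gen_superset[of "elts J \<union> elts (Idl (I_gt (elts I)))"]
      by (intro idl_plus_le) (auto simp: less_eq_idl_def elts_Gen)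
  qed
  finally show ?thesis by (auto simp: elts_plus L)
qed

subsection \<open>Binomial transforms\<close>

text \<open>Umbrally \<open>(a + c) ^ n\<close>, where the powers \<open>a ^ i\<close> stand for the terms of the sequence.\<close>
definition umbral :: "(nat \<Rightarrow> 'a::comm_ring_1) \<Rightarrow> 'a \<Rightarrow> nat \<Rightarrow> 'a" where
  "umbral a c n = (\<Sum>i\<le>n. of_nat (n choose i) * a i * c ^ (n - i))"

lemma umbral_0 [simp]: "umbral a c 0 = a 0"
  by (simp add: umbral_def)

lemma umbral_Suc: "umbral a c (Suc n) = umbral (\<lambda>i. a (Suc i)) c n + c * umbral a c n"
proof -
  have "umbral a c (Suc n) = a 0 * c ^ Suc n +
      (\<Sum>i\<le>n. (of_nat (n choose i) + of_nat (n choose Suc i)) * a (Suc i) * c ^ (n - i))"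
    unfolding umbral_def by (subst sum.atMost_Suc_shift) simp
  also have "\<dots> = umbral (\<lambda>i. a (Suc i)) c n +
      (a 0 * c ^ Suc n + (\<Sum>i\<le>n. of_nat (n choose Suc i) * a (Suc i) * c ^ (n - i)))"
    by (simp add: umbral_def distrib_right sum.distrib)
  also have "a 0 * c ^ Suc n + (\<Sum>i\<le>n. of_nat (n choose Suc i) * a (Suc i) * c ^ (n - i)) =
      (\<Sum>i\<le>Suc n. of_nat (n choose i) * a i * c ^ (Suc n - i))"
    by (subst sum.atMost_Suc_shift) simp
  also have "\<dots> = c * umbral a c n"
    by (simp add: umbral_def sum_distrib_left Suc_diff_le mult_ac binomial_eq_0)
  finally show ?thesis .
qed

lemma umbral_add: "umbral (\<lambda>i. a i + b i) c n = umbral a c n + umbral b c n"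
  by (simp add: umbral_def algebra_simps sum.distrib)

lemma umbral_mult_left: "umbral (\<lambda>i. x * a i) c n = x * umbral a c n"
  by (simp add: umbral_def sum_distrib_left mult_ac)

lemma umbral_umbral: "umbral (umbral a x) y n = umbral a (x + y) n"
proof (induction n arbitrary: a)
  case (Suc n)
  have "umbral (umbral a x) y (Suc n) =
      umbral (\<lambda>i. umbral (\<lambda>i. a (Suc i)) x i + x * umbral a x i) y n + y * umbral (umbral a x) y n"
    unfolding umbral_Suc[of "umbral a x"] umbral_Suc[of a] ..
  also have "\<dots> = umbral (\<lambda>i. a (Suc i)) (x + y) n + (x + y) * umbral a (x + y) n"
    by (simp only: umbral_add umbral_mult_left Suc.IH) (simp add: algebra_simps)
  finally show ?case by (simp only: umbral_Suc[of a])
qed simp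

lemma umbral_zero_arg: "umbral a 0 n = a n"
  by (induction n arbitrary: a) (simp_all add: umbral_Suc)

lemma umbral_powers: "umbral (\<lambda>i. x ^ i) c n = (x + c) ^ n"
  by (simp add: umbral_def binomial_ring)

lemma umbral_cong: "(\<And>i. i \<le> n \<Longrightarrow> a i = b i) \<Longrightarrow> umbral a c n = umbral b c n"
  by (simp add: umbral_def)

lemma umbral_scale: "umbral (\<lambda>i. t ^ i * a i) (t * c) n = t ^ n * umbral a c n"
proof -
  have "t ^ n = t ^ i * t ^ (n - i)" if "i \<le> n" for i using that by (simp flip: power_add)
  then show ?thesis
    unfolding umbral_def sum_distrib_left
    by (intro sum.cong refl) (simp add: power_mult_distrib mult_ac)
qed

lemma umbral_mem:
  assumes "\<And>i. i \<le> n \<Longrightarrow> a i \<in> elts (J ^ i)" "c \<in> elts K" "J \<le> K"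
  shows "umbral a c n \<in> elts (K ^ n)"
  unfolding umbral_def mult.assoc
  using assms by (intro elts_sum elts_rules(3) elts_times_power_plus) auto

lemma finite_difference_vanishing:
  assumes high: "\<And>i. i > q \<Longrightarrow> y i \<in> elts Y"
    and mid: "\<And>n. n \<in> {q+1..2*q+1} \<Longrightarrow> umbral y 1 n \<in> elts Y"
  shows "y 0 \<in> elts Y"
proof -
  define S where "S j = umbral (\<lambda>i. y (j + i)) 1" for j
  have rec: "S j (Suc n) = S (Suc j) n + S j n" for j n
    unfolding S_def umbral_Suc by simp
  have 1: "S j n \<in> elts Y" if "q + 1 \<le> n" "n + j \<le> 2 * q + 1" for j n
    using that
  proof (induction j arbitrary: n)
    case 0
    then show ?case using mid by (simp add: S_def)
  next
    case (Suc j)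
    then have "S j (Suc n) - S j n \<in> elts Y" by (intro elts_diff) auto
    then show ?case by (simp add: rec)
  qed
  have 2: "S (Suc q - d) n \<in> elts Y" if "d \<le> Suc q" "n \<le> Suc q" for d n
    using that
  proof (induction d arbitrary: n)
    case 0
    show ?case unfolding S_def umbral_def
      by (intro elts_sum elts_rules(3,4) high) simp
  next
    case (Suc d)
    show ?case using Suc.prems(2)
    proof (induction n rule: inc_induct)
      case base
      then show ?case using Suc.prems by (intro 1) auto
    next
      case (step n)
      have "S (Suc q - d) n \<in> elts Y" using Suc step by simp
      moreover have "Suc q - d = Suc (Suc q - Suc d)" using Suc.prems by simp
      ultimately have "S (Suc q - Suc d) (Suc n) - S (Suc (Suc q - Suc d)) n \<in> elts Y"
        using step by (intro elts_diff) simp_all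
      then show ?case by (simp add: rec)
    qed
  qed
  show ?thesis using 2[of "Suc q" 0] by (simp add: S_def)
qed

lemma power_mem_of_umbral:
  assumes "a 0 = 1"
    and zero: "\<And>n. n \<in> {q+1..2*q+1} \<Longrightarrow> umbral a c n = 0"
    and high: "\<And>i. i \<in> {q+1..2*q+1} \<Longrightarrow> a i * c ^ (2*q+1-i) \<in> elts Y"
  shows "c ^ (2*q+1) \<in> elts Y"
proof -
  define y where "y i = (if i \<le> 2*q+1 then a i * c ^ (2*q+1-i) else 0)" for i
  have "y 0 \<in> elts Y"
  proof (rule finite_difference_vanishing[of q])
    show "y i \<in> elts Y" if "i > q" for i
      using high[of i] that by (simp add: y_def elts_rules)
  next
    fix n assume n: "n \<in> {q+1..2*q+1}"
    have "y i = a i * (c ^ (n - i) * c ^ (2*q+1-n))" if "i \<le> n" for i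
      using that n by (simp add: y_def flip: power_add)
    then have "umbral y 1 n = umbral a c n * c ^ (2*q+1-n)"
      unfolding umbral_def sum_distrib_right by (intro sum.cong) (auto simp: mult_ac)
    then show "umbral y 1 n \<in> elts Y" using zero[OF n] by (simp add: elts_rules)
  qed
  then show ?thesis using assms(1) by (simp add: y_def)
qed

lemma weak_subint_closure_iff:
  "b \<in> weak_subint_closure (elts J) \<longleftrightarrow>
    (\<exists>q a. a 0 = 1 \<and> (\<forall>i. a i \<in> elts (J ^ i)) \<and> (\<forall>n\<in>{q+1..2*q+1}. umbral a b n = 0))"
proof -
  have eq: "umbral a b n = b ^ n + (\<Sum>i=1..n. of_nat (n choose i) * a i * b ^ (n - i))"
    if "a 0 = 1" for a n
    unfolding umbral_def using that
    by (simp add: atMost_atLeast0 sum.atLeast_Suc_atMost)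
  show ?thesis
  proof
    assume "b \<in> weak_subint_closure (elts J)"
    then obtain q a where a: "\<And>i. i \<in> {1..2*q+1} \<Longrightarrow> a i \<in> elts (J ^ i)"
      and z: "\<And>n. n \<in> {q+1..2*q+1} \<Longrightarrow>
        b ^ n + (\<Sum>i=1..n. of_nat (n choose i) * a i * b ^ (n - i)) = 0"
      unfolding weak_subint_closure_def elts_ideal_pow by blast
    define a' where "a' i = (if i = 0 then 1 else if i \<le> 2*q+1 then a i else 0)" for i
    have "a' i \<in> elts (J ^ i)" for i
      using a[of i] by (auto simp: a'_def elts_one elts_rules)
    moreover have "umbral a' b n = 0" if n: "n \<in> {q+1..2*q+1}" for n
    proof -
      have "umbral a' b n = b ^ n + (\<Sum>i=1..n. of_nat (n choose i) * a' i * b ^ (n - i))"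
        by (rule eq) (simp add: a'_def)
      also have "(\<Sum>i=1..n. of_nat (n choose i) * a' i * b ^ (n - i)) =
          (\<Sum>i=1..n. of_nat (n choose i) * a i * b ^ (n - i))"
        using n by (intro sum.cong) (auto simp: a'_def)
      finally show ?thesis using z[OF n] by simp
    qed
    ultimately show "\<exists>q a. a 0 = 1 \<and> (\<forall>i. a i \<in> elts (J ^ i)) \<and> (\<forall>n\<in>{q+1..2*q+1}. umbral a b n = 0)"
      by (intro exI[of _ q] exI[of _ a']) (auto simp: a'_def)
  next
    assume "\<exists>q a. a 0 = 1 \<and> (\<forall>i. a i \<in> elts (J ^ i)) \<and> (\<forall>n\<in>{q+1..2*q+1}. umbral a b n = 0)"
    then obtain q a where "a 0 = 1" "\<forall>i. a i \<in> elts (J ^ i)" "\<forall>n\<in>{q+1..2*q+1}. umbral a b n = 0"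
      by blast
    then show "b \<in> weak_subint_closure (elts J)"
      unfolding weak_subint_closure_def mem_Collect_eq elts_ideal_pow[symmetric]
      by (intro exI[of _ q] exI[of _ a]) (simp only: eq, blast)
  qed
qed

text \<open>Umbrally, the coefficients are powers of \<open>e - b\<close>, where \<open>e\<close> has moments \<open>c ^ i\<close> up to
  order \<open>q\<close> and vanishing moments beyond.\<close>
lemma weak_subint_closureI:
  assumes j: "j \<in> elts J" and c: "\<And>k. k > q \<Longrightarrow> c ^ k \<in> elts (J ^ k)"
  shows "j + c \<in> weak_subint_closure (elts J)"
proof -
  define e where "e i = (if i \<le> q then c ^ i else 0)" for i
  define d where "d = umbral e (- c)"
  have d: "d k \<in> elts (J ^ k)" for k
  proof (cases "k \<le> q")
    case True
    have "d k = umbral (\<lambda>i. c ^ i) (- c) k"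
      unfolding d_def using True by (intro umbral_cong) (simp add: e_def)
    then have "d k = 0 ^ k" by (simp only: umbral_powers) simp
    then show ?thesis by (cases k) (simp_all add: elts_one elts_rules)
  next
    case False
    have "of_nat (k choose i) * e i * (- c) ^ (k - i) \<in> elts (J ^ k)" if "i \<le> k" for i
    proof (cases "i \<le> q")
      case True
      have "of_nat (k choose i) * e i * (- c) ^ (k - i) =
          (of_nat (k choose i) * (- 1) ^ (k - i)) * (c ^ i * c ^ (k - i))"
        using True by (simp add: e_def power_minus[of c] mult_ac)
      also have "c ^ i * c ^ (k - i) = c ^ k" using that by (simp flip: power_add)
      finally show ?thesis using False c by (simp add: elts_rules)
    qed (simp add: e_def elts_rules)
    then show ?thesis unfolding d_def umbral_def by (intro elts_sum) simp
  qed
  have "umbral (umbral d (- j)) (j + c) n = e n" for n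
    unfolding d_def umbral_umbral by (simp add: umbral_zero_arg)
  moreover have "umbral d (- j) 0 = 1" by (simp add: d_def e_def)
  moreover have "umbral d (- j) i \<in> elts (J ^ i)" for i
    by (intro umbral_mem[of _ _ J] d elts_uminus j order_refl)
  ultimately show ?thesis
    unfolding weak_subint_closure_iff
    by (intro exI[of _ q] exI[of _ "umbral d (- j)"]) (auto simp: e_def)
qed

lemma ideal_sum_le_weak_subint_closure:
  assumes "red J I"
  shows "ideal_sum (elts J) (I_gt (elts I)) \<subseteq> weak_subint_closure (elts J)"
proof
  fix x assume "x \<in> ideal_sum (elts J) (I_gt (elts I))"
  then obtain j c where j: "j \<in> elts J" and c: "c \<in> I_gt (elts I)" and x: "x = j + c"
    unfolding ideal_sum_I_gt_iff by blast
  obtain r where r: "\<forall>s. I ^ (s + r) \<le> J ^ s * I ^ r" using assms by (rule red_powerE)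
  obtain q where q: "\<And>k. k \<ge> q \<Longrightarrow> c ^ k \<in> elts (I ^ (k + r))"
    using I_gt_eventually[OF c] by blast
  have "c ^ k \<in> elts (J ^ k)" if "k > q" for k
    using idl_leD[OF order_trans[OF r[rule_format] idl_mult_le(1)] q] that by simp
  then show "x \<in> weak_subint_closure (elts J)"
    unfolding x by (rule weak_subint_closureI[OF j])
qed

subsection \<open>Multiple roots over a field\<close>

text \<open>In characteristic 0 and for \<open>a 0 = 1\<close>: \<open>y\<close> is a root of multiplicity at least \<open>q + 1\<close> of
  \<open>\<lambda>y. umbral a y (2*q+1)\<close>, as the transforms of lower order are its derivatives up to constants.\<close>
definition wroot :: "nat \<Rightarrow> (nat \<Rightarrow> 'a::comm_ring_1) \<Rightarrow> 'a \<Rightarrow> bool" where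
  "wroot q a y \<longleftrightarrow> (\<forall>n\<in>{q+1..2*q+1}. umbral a y n = 0)"

lemma wroot_unique:
  fixes x y :: "'k::field"
  assumes "a 0 = 1" "wroot q a x" "wroot q a y"
  shows "x = y"
proof -
  have "(y - x) ^ (2*q+1) \<in> elts 0"
  proof (rule power_mem_of_umbral)
    show "umbral a x 0 = 1" using assms by simp
    show "umbral (umbral a x) (y - x) n = 0" if "n \<in> {q+1..2*q+1}" for n
      using assms that by (simp add: umbral_umbral wroot_def)
    show "umbral a x i * (y - x) ^ (2*q+1-i) \<in> elts 0" if "i \<in> {q+1..2*q+1}" for i
      using assms that by (simp add: wroot_def elts_zero)
  qed
  then show ?thesis by (auto simp: elts_zero)
qed

lemma wroot_scale: "wroot q a y \<Longrightarrow> wroot q (\<lambda>i. t ^ i * a i) (t * y)"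
  by (simp add: wroot_def umbral_scale)

lemma umbral_hom:
  assumes "h 0 = 0" "h 1 = 1" "\<And>x y. h (x + y) = h x + h y" "\<And>x y. h (x * y) = h x * h y"
  shows "h (umbral a c n) = umbral (\<lambda>i. h (a i)) (h c) n"
proof (induction n arbitrary: a)
  case (Suc n)
  show ?case unfolding umbral_Suc using assms Suc by simp
qed simp

lemma degree_umbral_X:
  "degree (umbral (\<lambda>i. [:a i:]) [:0, 1:] n) \<le> n \<and> coeff (umbral (\<lambda>i. [:a i:]) [:0, 1:] n) n = a 0"
proof (induction n arbitrary: a)
  case (Suc n)
  have "degree (umbral (\<lambda>i. [:a (Suc i):]) [:0, 1:] n) \<le> n"
    "degree (umbral (\<lambda>i. [:a i:]) [:0, 1:] n) \<le> n"
    "coeff (umbral (\<lambda>i. [:a i:]) [:0, 1:] n) n = a 0"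
    using Suc by auto
  then show ?case
    unfolding umbral_Suc
    by (auto intro!: degree_add_le simp: coeff_eq_0 degree_pCons_le le_SucI order_trans[OF degree_pCons_le])
qed simp

lemma umbral_const_poly: "umbral (\<lambda>i. [:a i:]) [:y:] n = [:umbral a y n:]"
  by (rule umbral_hom[where h = "\<lambda>x. [:x:]", symmetric]) (auto simp: one_pCons mult_ac)

lemma wroot_dvd:
  assumes "wroot q a y"
  shows "[:- y, 1:] ^ Suc q dvd umbral (\<lambda>i. [:a i:]) [:0, 1:] (2*q+1)"
proof -
  have eq: "umbral (\<lambda>i. [:a i:]) [:0, 1:] (2*q+1) =
      umbral (\<lambda>i. [:umbral a y i:]) [:- y, 1:] (2*q+1)"
    using umbral_umbral[of "\<lambda>i. [:a i:]" "[:y:]" "[:- y, 1:]"]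
    by (simp add: umbral_const_poly[abs_def])
  have "[:- y, 1:] ^ Suc q dvd [:umbral a y i:] * [:- y, 1:] ^ (2*q+1-i)" if "i \<le> 2*q+1" for i
  proof (cases "i \<le> q")
    case True
    then show ?thesis by (intro dvd_mult le_imp_power_dvd) simp
  next
    case False
    then show ?thesis using assms that by (simp add: wroot_def)
  qed
  then show ?thesis
    unfolding eq umbral_def[of "\<lambda>i. [:umbral a y i:]"] mult.assoc
    by (intro dvd_sum) (metis atMost_iff dvd_mult)
qed

definition spec :: "'k::field \<Rightarrow> 'k poly poly \<Rightarrow> 'k poly" where
  "spec t = map_poly (\<lambda>p. poly p t)"

lemma coeff_spec: "coeff (spec t S) n = poly (coeff S n) t"
  by (simp add: spec_def coeff_map_poly)

lemma spec_simps [simp]: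
  "spec t 0 = 0" "spec t 1 = 1" "spec t (S + T) = spec t S + spec t T"
  "spec t (S * T) = spec t S * spec t T"
  "spec t (smult a S) = smult (poly a t) (spec t S)"
  "spec t (pCons a S) = pCons (poly a t) (spec t S)"
  "spec t (S ^ n) = spec t S ^ n"
proof -
  show m: "spec t (S * T) = spec t S * spec t T" for S T
    by (rule poly_eqI) (simp add: coeff_spec coeff_mult poly_sum)
  show o: "spec t 1 = 1"
    by (rule poly_eqI) (simp add: coeff_spec)
  show "spec t (S ^ n) = spec t S ^ n"
    by (induction n) (simp_all add: m o)
  show "spec t (pCons a S) = pCons (poly a t) (spec t S)"
    by (rule poly_eqI) (simp add: coeff_spec coeff_pCons split: nat.split)
qed (rule poly_eqI; simp add: coeff_spec)+

lemma spec_pderiv: "spec t (pderiv S) = pderiv (spec t S)"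
  by (rule poly_eqI) (simp add: coeff_spec coeff_pderiv)

lemma order_eq_1I:
  fixes p :: "'k::field poly"
  assumes "poly p y = 0" "poly (pderiv p) y \<noteq> 0"
  shows "order y p = 1"
proof -
  have p: "p \<noteq> 0" using assms by auto
  have "\<not> [:- y, 1:] ^ 2 dvd p"
  proof
    define z where "z = [:- y, 1:]"
    have z: "poly z y = 0" by (simp add: z_def)
    assume "[:- y, 1:] ^ 2 dvd p"
    then obtain r where "p = z ^ 2 * r" unfolding z_def by (rule dvdE)
    then have "poly (pderiv p) y = 0" by (simp add: power2_eq_square mult.assoc pderiv_mult z)
    then show False using assms by simp
  qed
  then have "order y p < 2" using p by (simp add: order_divides)
  moreover have "order y p \<noteq> 0" using assms p order_root by blast
  ultimately show ?thesis by simp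
qed

lemma linear_poly_eq: "degree p \<le> 1 \<Longrightarrow> p = [:coeff p 0, coeff p 1:]"
  by (intro poly_eqI) (auto simp: coeff_pCons coeff_eq_0 split: nat.split)

lemma poly_zero_infinite: "infinite E \<Longrightarrow> (\<And>t. t \<in> E \<Longrightarrow> poly p t = 0) \<Longrightarrow> p = (0 :: 'k::field poly)"
  using poly_roots_finite[of p] finite_subset[of E "{t. poly p t = 0}"] by blast

text \<open>A function \<open>\<beta>\<close> whose values are such roots is rational: among all bivariate polynomials
  vanishing along the graph of \<open>\<beta>\<close> over an infinite set, one of least degree has its
  \<open>(q+1)\<close>-st power dividing a polynomial of degree \<open>2q+1\<close>, hence is linear.\<close>
lemma wroot_rational:
  fixes \<alpha> :: "nat \<Rightarrow> 'k::field poly"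
  assumes char0: "\<And>n. n \<ge> 1 \<Longrightarrow> (of_nat n :: 'k) \<noteq> 0"
    and inf: "infinite (UNIV :: 'k set)"
    and \<alpha>0: "\<alpha> 0 = 1"
    and root: "\<And>t. wroot q (\<lambda>i. poly (\<alpha> i) t) (\<beta> t)"
  shows "\<exists>E D N. infinite E \<and> D \<noteq> 0 \<and> (\<forall>t\<in>E. poly N t = poly D t * \<beta> t)"
proof -
  define vn where "vn E S \<longleftrightarrow> infinite E \<and> S \<noteq> 0 \<and> (\<forall>t\<in>E. poly (spec t S) (\<beta> t) = 0)" for E S
  define P where "P = umbral (\<lambda>i. [:\<alpha> i:]) [:0, 1:] (2*q+1)"
  have specP: "spec t P = umbral (\<lambda>i. [:poly (\<alpha> i) t:]) [:0, 1:] (2*q+1)" for t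
    unfolding P_def by (subst umbral_hom[where h = "spec t"]) auto
  have "coeff P (2*q+1) = 1" using degree_umbral_X[of \<alpha> "2*q+1"] \<alpha>0 by (simp add: P_def)
  then have P0: "P \<noteq> 0" by auto
  have specP0: "spec t P \<noteq> 0" for t
    using \<open>coeff P (2*q+1) = 1\<close> by (metis coeff_0 coeff_spec poly_1 zero_neq_one)
  have degP: "degree P \<le> 2*q+1" using degree_umbral_X[of \<alpha> "2*q+1"] by (simp add: P_def)
  have dvdP: "[:- \<beta> t, 1:] ^ Suc q dvd spec t P" for t
    unfolding specP by (rule wroot_dvd) (rule root)
  have "poly (spec t P) (\<beta> t) = 0" for t
    using dvdP[of t] by (auto simp: dvd_def)
  then have "vn UNIV P" using inf P0 by (simp add: vn_def)
  then have "vn (fst (UNIV, P)) (snd (UNIV, P))" by simp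
  then obtain x where "vn (fst x) (snd x)"
    and x: "\<And>y. vn (fst y) (snd y) \<Longrightarrow> degree (snd x) \<le> degree (snd y)"
    using ex_has_least_nat[where P = "\<lambda>x. vn (fst x) (snd x)" and m = "\<lambda>x. degree (snd x)"] by blast
  moreover obtain E R where "x = (E, R)" by fastforce
  ultimately have R: "vn E R" and least: "\<And>E' S. vn E' S \<Longrightarrow> degree R \<le> degree S"
    using x[of "(E', S)" for E' S] by auto
  have R0: "R \<noteq> 0" and E: "infinite E" and RE: "\<And>t. t \<in> E \<Longrightarrow> poly (spec t R) (\<beta> t) = 0"
    using R by (auto simp: vn_def)
  have divide: "\<exists>a Q. a \<noteq> 0 \<and> smult a S = R * Q"
    if "infinite E'" "E' \<subseteq> E" and S: "\<And>t. t \<in> E' \<Longrightarrow> poly (spec t S) (\<beta> t) = 0" for E' S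
  proof -
    obtain a Q where a: "a \<noteq> 0" "smult a S = R * Q + pseudo_mod S R"
      using pseudo_mod(1)[OF R0] by blast
    have "poly (spec t (pseudo_mod S R)) (\<beta> t) = 0" if "t \<in> E'" for t
    proof -
      have "poly (spec t (smult a S)) (\<beta> t) = 0" using S[OF that] by simp
      then show ?thesis using RE that \<open>E' \<subseteq> E\<close> unfolding a by auto
    qed
    then have "pseudo_mod S R = 0"
      using least[of E' "pseudo_mod S R"] pseudo_mod(2)[OF R0, of S] \<open>infinite E'\<close> unfolding vn_def
      by (metis not_le)
    then show ?thesis using a by auto
  qed
  have degR: "degree R \<noteq> 0"
  proof
    assume "degree R = 0"
    then obtain r where r: "R = [:r:]" using degree_eq_zeroE by blast
    then have "poly r t = 0" if "t \<in> E" for t using RE[OF that] by simp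
    then show False using R0 r poly_zero_infinite[OF E, of r] by auto
  qed
  have pR: "pderiv R \<noteq> 0" "degree (pderiv R) < degree R"
  proof -
    have "of_nat (degree R) \<noteq> (0 :: 'k poly)" using char0[of "degree R"] degR by (simp add: of_nat_poly)
    then have "coeff (pderiv R) (degree R - 1) \<noteq> 0"
      using degR R0 by (simp add: coeff_pderiv)
    then show "pderiv R \<noteq> 0" by auto
    have "degree (pderiv R) \<le> degree R - 1"
      by (rule degree_le) (auto simp: coeff_pderiv coeff_eq_0)
    then show "degree (pderiv R) < degree R" using degR by simp
  qed
  define E1 where "E1 = {t \<in> E. poly (pderiv (spec t R)) (\<beta> t) \<noteq> 0}"
  have "finite {t \<in> E. poly (pderiv (spec t R)) (\<beta> t) = 0}"
    using least[of "{t \<in> E. poly (pderiv (spec t R)) (\<beta> t) = 0}" "pderiv R"] pR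
    by (auto simp: vn_def spec_pderiv)
  then have "infinite (E - {t \<in> E. poly (pderiv (spec t R)) (\<beta> t) = 0})" using E by (rule Diff_infinite_finite)
  also have "E - {t \<in> E. poly (pderiv (spec t R)) (\<beta> t) = 0} = E1" by (auto simp: E1_def)
  finally have E1: "infinite E1" .
  have "\<exists>a Q. a \<noteq> 0 \<and> smult a P = R ^ j * Q" if "j \<le> Suc q" for j
    using that
  proof (induction j)
    case 0
    show ?case by (rule exI[of _ 1]) simp
  next
    case (Suc j)
    then obtain a Q where aQ: "a \<noteq> 0" "smult a P = R ^ j * Q" by auto
    define E2 where "E2 = E1 - {t. poly a t = 0}"
    have E2: "infinite E2" unfolding E2_def
      using poly_roots_finite[OF aQ(1)] E1 by (rule Diff_infinite_finite)
    have "E2 \<subseteq> E" by (auto simp: E2_def E1_def)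
    have "poly (spec t Q) (\<beta> t) = 0" if t: "t \<in> E2" for t
    proof -
      have a: "poly a t \<noteq> 0" using t by (simp add: E2_def)
      have eq: "smult (poly a t) (spec t P) = spec t R ^ j * spec t Q"
        using arg_cong[OF aQ(2), of "spec t"] by simp
      then have nz: "spec t R ^ j * spec t Q \<noteq> 0" using a specP0 by (metis smult_eq_0_iff)
      have "[:- \<beta> t, 1:] ^ Suc q dvd spec t R ^ j * spec t Q"
        unfolding eq[symmetric] by (rule dvd_smult) (rule dvdP)
      then have "Suc q \<le> order (\<beta> t) (spec t R ^ j * spec t Q)"
        using nz order_divides by blast
      also have "\<dots> = order (\<beta> t) (spec t R ^ j) + order (\<beta> t) (spec t Q)"
        using nz by (rule order_mult)
      also have "order (\<beta> t) (spec t R ^ i) = i" for i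
      proof -
        have "order (\<beta> t) (spec t R) = 1"
          using t RE by (intro order_eq_1I) (auto simp: E2_def E1_def)
        moreover have "spec t R \<noteq> 0" using t by (auto simp: E2_def E1_def)
        ultimately show ?thesis by (induction i) (simp_all add: order_mult)
      qed
      finally have "order (\<beta> t) (spec t Q) \<noteq> 0" using Suc.prems by simp
      then show ?thesis using order_root by blast
    qed
    then obtain b Q' where b: "b \<noteq> 0" "smult b Q = R * Q'"
      using divide[OF E2 \<open>E2 \<subseteq> E\<close>] by blast
    have "smult (b * a) P = R ^ j * smult b Q" by (simp add: aQ(2) flip: smult_smult)
    then have "smult (b * a) P = R ^ Suc j * Q'" by (simp add: b(2) mult_ac)
    moreover have "b * a \<noteq> 0" using aQ(1) b(1) by simp
    ultimately show ?case by blast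
  qed
  then obtain a Q where aQ: "a \<noteq> 0" "smult a P = R ^ Suc q * Q" by blast
  then have "R ^ Suc q * Q \<noteq> 0" using P0 by (metis smult_eq_0_iff)
  then have "degree (R ^ Suc q * Q) = Suc q * degree R + degree Q"
    by (subst degree_mult_eq) (auto simp: degree_power_eq R0 degree_mult_eq)
  moreover have "degree (smult a P) = degree P" using aQ(1) by simp
  ultimately have "Suc q * degree R \<le> 2*q+1" using degP aQ(2) by simp
  then have "degree R < 2"
    using mult_le_mono2[of 2 "degree R" "Suc q"] by (cases "degree R < 2") auto
  then have "degree R = 1" using degR by simp
  then have "coeff R 1 \<noteq> 0" using R0 by (metis leading_coeff_0_iff)
  moreover have "R = [:coeff R 0, coeff R 1:]"
    by (rule linear_poly_eq) (simp add: \<open>degree R = 1\<close>)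
  ultimately obtain N D where ND: "R = [:N, D:]" "D \<noteq> 0" by blast
  have "poly (- N) t = poly D t * \<beta> t" if "t \<in> E" for t
  proof -
    have "poly N t + \<beta> t * poly D t = 0" using RE[OF that] by (simp add: ND(1))
    then show ?thesis by (simp add: minus_unique mult.commute)
  qed
  then show ?thesis using E ND(2) by blast
qed

lemma wroot_linear:
  fixes \<alpha> :: "nat \<Rightarrow> 'k::field poly"
  assumes char0: "\<And>n. n \<ge> 1 \<Longrightarrow> (of_nat n :: 'k) \<noteq> 0"
    and inf: "infinite (UNIV :: 'k set)"
    and closed: "\<And>p :: 'k poly. degree p > 0 \<Longrightarrow> \<exists>x. poly p x = 0"
    and \<alpha>0: "\<alpha> 0 = 1" and deg: "\<And>i. degree (\<alpha> i) \<le> i"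
    and root: "\<And>t. wroot q (\<lambda>i. poly (\<alpha> i) t) (\<beta> t)"
  shows "\<exists>c e. \<forall>t. \<beta> t = c + e * t"
proof -
  define frac where "frac x \<longleftrightarrow> (case x of (D, N) \<Rightarrow>
    D \<noteq> 0 \<and> (\<exists>E. infinite E \<and> (\<forall>t\<in>E. poly N t = poly D t * \<beta> t)))" for x
  have "\<exists>x. frac x"
    using wroot_rational[of \<alpha> q \<beta>, OF char0 inf \<alpha>0 root] by (auto simp: frac_def)
  then obtain x where x: "frac x" "\<And>y. frac y \<Longrightarrow> degree (fst x) \<le> degree (fst y)"
    using ex_has_least_nat[of frac _ "\<lambda>x. degree (fst x)"] by blast
  obtain D N where xDN: "x = (D, N)" by fastforce
  obtain E where D: "D \<noteq> 0" and E: "infinite E" and DN: "\<And>t. t \<in> E \<Longrightarrow> poly N t = poly D t * \<beta> t"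
    using x(1) unfolding xDN frac_def by auto
  have poly_umbral: "poly (umbral a c n) t = umbral (\<lambda>i. poly (a i) t) (poly c t) n"
    for a and c :: "'k poly" and n t
    by (rule umbral_hom) auto
  have "degree D = 0"
  proof (rule ccontr)
    assume "degree D \<noteq> 0"
    then obtain t0 where t0: "poly D t0 = 0" using closed by auto
    have "umbral (\<lambda>i. D ^ i * \<alpha> i) N (2*q+1) = 0"
    proof (rule poly_zero_infinite[OF E])
      fix t assume "t \<in> E"
      then show "poly (umbral (\<lambda>i. D ^ i * \<alpha> i) N (2*q+1)) t = 0"
        using root[of t] by (simp add: poly_umbral DN umbral_scale wroot_def)
    qed
    then have "umbral (\<lambda>i. 0 ^ i * poly (\<alpha> i) t0) (poly N t0) (2*q+1) = 0"
      using poly_umbral[of "\<lambda>i. D ^ i * \<alpha> i" N "2*q+1" t0] t0 by simp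
    moreover have "umbral (\<lambda>i. 0 ^ i * poly (\<alpha> i) t0) y n = y ^ n" for y n
      unfolding umbral_def
      by (subst sum.mono_neutral_right[of _ "{0}"]) (auto simp: \<alpha>0)
    ultimately have "poly N t0 = 0" by auto
    then obtain N' D' where N': "N = [:- t0, 1:] * N'" and D': "D = [:- t0, 1:] * D'"
      using t0 by (metis dvdE poly_eq_0_iff_dvd)
    have "D' \<noteq> 0" using D D' by auto
    have "poly N' t = poly D' t * \<beta> t" if "t \<in> E - {t0}" for t
      using DN[of t] that by (simp add: N' D' mult.assoc) (simp flip: mult.assoc left_diff_distrib)
    moreover have "infinite (E - {t0})" using E by simp
    ultimately have "frac (D', N')" using \<open>D' \<noteq> 0\<close> unfolding frac_def by blast
    then have "degree D \<le> degree D'" using x(2)[of "(D', N')"] xDN by simp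
    moreover have "degree D = Suc (degree D')"
      unfolding D' using \<open>D' \<noteq> 0\<close> by (subst degree_mult_eq) auto
    ultimately show False by simp
  qed
  then obtain d where d: "D = [:d:]" "d \<noteq> 0" using D by (metis degree_eq_zeroE pCons_0_0)
  define l where "l = smult (inverse d) N"
  have l: "poly l t = \<beta> t" if "t \<in> E" for t using DN[OF that] d by (simp add: l_def)
  have zero: "umbral \<alpha> l n = 0" if "n \<in> {q+1..2*q+1}" for n
  proof (rule poly_zero_infinite[OF E])
    fix t assume "t \<in> E"
    then show "poly (umbral \<alpha> l n) t = 0"
      using root[of t] that by (simp add: poly_umbral l wroot_def)
  qed
  have "wroot q (\<lambda>i. poly (\<alpha> i) t) (poly l t)" for t
    unfolding wroot_def poly_umbral[symmetric] using zero by simp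
  then have \<beta>: "\<beta> t = poly l t" for t
    using wroot_unique[of "\<lambda>i. poly (\<alpha> i) t"] root[of t] \<alpha>0 by simp
  have "degree l \<le> 1"
  proof (rule ccontr)
    assume big: "\<not> degree l \<le> 1"
    define n where "n = 2*q+1"
    have "umbral \<alpha> l n = l ^ n + (\<Sum>i=1..n. of_nat (n choose i) * \<alpha> i * l ^ (n - i))"
      by (simp add: umbral_def atMost_atLeast0 sum.atLeast_Suc_atMost \<alpha>0)
    then have "l ^ n = - (\<Sum>i=1..n. of_nat (n choose i) * \<alpha> i * l ^ (n - i))"
      using zero[of n] unfolding eq_neg_iff_add_eq_0 by (simp only: n_def) simp
    moreover have "degree (\<Sum>i=1..n. of_nat (n choose i) * \<alpha> i * l ^ (n - i)) < degree l * n"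
    proof (rule degree_sum_less)
      show "0 < degree l * n" using big by (simp add: n_def)
      fix i assume i: "i \<in> {1..n}"
      have "degree (of_nat (n choose i) * \<alpha> i * l ^ (n - i)) \<le>
          degree (of_nat (n choose i) * \<alpha> i) + degree (l ^ (n - i))" by (rule degree_mult_le)
      also have "degree (of_nat (n choose i) * \<alpha> i) \<le> i"
        using degree_mult_le[of "of_nat (n choose i)" "\<alpha> i"] deg[of i] by simp
      also have "degree (l ^ (n - i)) \<le> degree l * (n - i)" by (rule degree_power_le)
      also have "i + degree l * (n - i) < degree l * i + degree l * (n - i)" using big i by simp
      also have "\<dots> = degree l * n" using i by (simp flip: distrib_left)
      finally show "degree (of_nat (n choose i) * \<alpha> i * l ^ (n - i)) < degree l * n" by simp
    qed
    ultimately have "degree (l ^ n) < degree l * n" by simp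
    moreover have "l \<noteq> 0" using big by auto
    ultimately show False by (simp add: degree_power_eq mult.commute)
  qed
  then obtain c e where "l = [:c, e:]" using linear_poly_eq by blast
  then have "\<beta> t = c + e * t" for t unfolding \<beta> by simp
  then show ?thesis by blast
qed

subsection \<open>Forms in a system of generators\<close>

locale local_residue =
  fixes \<phi> :: "'a::comm_ring_1 \<Rightarrow> 'k::field" and M :: "'a idl"
  assumes noeth: "noetherian_ring TYPE('a)"
    and loc: "local_ring_max (elts M)"
    and \<phi>_1 [simp]: "\<phi> 1 = 1"
    and \<phi>_add [simp]: "\<phi> (x + y) = \<phi> x + \<phi> y"
    and \<phi>_mult [simp]: "\<phi> (x * y) = \<phi> x * \<phi> y"
    and \<phi>_eq_0_iff: "\<phi> x = 0 \<longleftrightarrow> x \<in> elts M"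
    and surj_\<phi>: "surj \<phi>"
    and alg_closed: "residue_field_alg_closed (elts M)"
    and char_0: "residue_field_char_0 (elts M)"
begin

lemma \<phi>_0 [simp]: "\<phi> 0 = 0"
  by (simp add: \<phi>_eq_0_iff elts_rules)

lemma \<phi>_of_nat: "\<phi> (of_nat n) = of_nat n"
  by (induction n) simp_all

lemma \<phi>_umbral: "\<phi> (umbral a c n) = umbral (\<lambda>i. \<phi> (a i)) (\<phi> c) n"
  by (rule umbral_hom) simp_all

lemma of_nat_nonzero: "n \<ge> 1 \<Longrightarrow> (of_nat n :: 'k) \<noteq> 0"
  using char_0 unfolding residue_field_char_0_def by (simp add: \<phi>_eq_0_iff flip: \<phi>_of_nat)

lemma infinite_k: "infinite (UNIV :: 'k set)"
proof -
  have "inj (of_nat :: nat \<Rightarrow> 'k)"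
  proof (rule injI)
    have *: "\<not> i < j" if "(of_nat i :: 'k) = of_nat j" for i j
    proof
      assume "i < j"
      then have "(of_nat (j - i) :: 'k) = 0" using that by (simp add: of_nat_diff)
      moreover have "j - i \<ge> 1" using \<open>i < j\<close> by simp
      ultimately show False using of_nat_nonzero by blast
    qed
    show "i = j" if "(of_nat i :: 'k) = of_nat j" for i j
      using *[of i j] *[of j i] that by simp
  qed
  then show ?thesis using infinite_UNIV_nat finite_imageD by (metis finite_subset subset_UNIV)
qed

lemma monic_root:
  assumes "degree g \<le> r" "coeff g r = 1" "r \<ge> 1"
  shows "\<exists>z. poly g z \<in> elts M"
proof -
  have r: "degree g = r" using assms le_degree[of g r] by simp
  have "poly g z = z ^ r + (\<Sum>i<r. coeff g i * z ^ i)" for z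
    unfolding poly_altdef r using assms(2) by (simp flip: lessThan_Suc_atMost)
  then show ?thesis using alg_closed assms(3) unfolding residue_field_alg_closed_def by metis
qed

lemma k_root:
  fixes p :: "'k poly"
  assumes "degree p > 0"
  shows "\<exists>x. poly p x = 0"
proof -
  define c where "c i = inv \<phi> (coeff p i / lead_coeff p)" for i
  have c: "\<phi> (c i) = coeff p i / lead_coeff p" for i
    unfolding c_def by (rule surj_f_inv_f[OF surj_\<phi>])
  obtain x where "x ^ degree p + (\<Sum>i<degree p. c i * x ^ i) \<in> elts M"
    using alg_closed assms unfolding residue_field_alg_closed_def
    by (metis One_nat_def Suc_leI)
  then have "\<phi> (x ^ degree p + (\<Sum>i<degree p. c i * x ^ i)) = 0" by (simp only: \<phi>_eq_0_iff)
  moreover have pow: "\<phi> (x ^ n) = \<phi> x ^ n" for n by (induction n) simp_all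
  moreover have "\<phi> (\<Sum>i<n. c i * x ^ i) = (\<Sum>i<n. coeff p i / lead_coeff p * \<phi> x ^ i)" for n
    by (induction n) (simp_all add: pow c)
  ultimately have "\<phi> x ^ degree p + (\<Sum>i<degree p. coeff p i / lead_coeff p * \<phi> x ^ i) = 0" by simp
  then have "lead_coeff p * (\<phi> x ^ degree p + (\<Sum>i<degree p. coeff p i / lead_coeff p * \<phi> x ^ i)) = 0"
    by simp
  moreover have "lead_coeff p \<noteq> 0" using assms by auto
  ultimately have "poly p (\<phi> x) = 0"
    by (simp add: poly_altdef distrib_left sum_distrib_left add.commute flip: lessThan_Suc_atMost)
  then show ?thesis ..
qed

text \<open>\<open>rep x d n a f\<close>: the element \<open>a\<close> is the value at \<open>x 0, \<dots>, x (d - 1)\<close> of a form of degree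
  \<open>n\<close> whose reduction modulo the maximal ideal is the polynomial function \<open>f\<close>. The function is
  not determined by \<open>a\<close>.\<close>
inductive rep :: "(nat \<Rightarrow> 'a) \<Rightarrow> nat \<Rightarrow> nat \<Rightarrow> 'a \<Rightarrow> ((nat \<Rightarrow> 'k) \<Rightarrow> 'k) \<Rightarrow> bool"
  for x d where
  const: "rep x d 0 a (\<lambda>_. \<phi> a)"
| var: "rep x d n a f \<Longrightarrow> i < d \<Longrightarrow> rep x d (Suc n) (x i * a) (\<lambda>l. l i * f l)"
| zero: "rep x d n 0 (\<lambda>_. 0)"
| add: "rep x d n a f \<Longrightarrow> rep x d n b g \<Longrightarrow> rep x d n (a + b) (\<lambda>l. f l + g l)"

lemma rep_smult: "rep x d n a f \<Longrightarrow> rep x d n (r * a) (\<lambda>l. \<phi> r * f l)"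
proof (induction rule: rep.induct)
  case (const a)
  then show ?case using rep.const[of x d "r * a"] by simp
next
  case (var n a f i)
  then show ?case using rep.var[OF var.IH var.hyps(2)] by (simp add: mult_ac)
next
  case (zero n)
  then show ?case using rep.zero by simp
next
  case (add n a f b g)
  then show ?case using rep.add[OF add.IH] by (simp add: distrib_left)
qed

lemma rep_mult: "rep x d n a f \<Longrightarrow> rep x d p b g \<Longrightarrow> rep x d (n + p) (a * b) (\<lambda>l. f l * g l)"
proof (induction rule: rep.induct)
  case (const a)
  then show ?case by (simp add: rep_smult)
next
  case (var n a f i)
  then show ?case using rep.var[OF var.IH[OF var.prems] var.hyps(2)] by (simp add: mult_ac)
next
  case (zero n)
  then show ?case using rep.zero by simp
next
  case (add n a f b' g')
  then show ?case using rep.add[OF add.IH(1,2)[OF add.prems]] by (simp add: distrib_right)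
qed

lemma rep_power: "rep x d 1 a f \<Longrightarrow> rep x d n (a ^ n) (\<lambda>l. f l ^ n)"
proof (induction n)
  case 0
  then show ?case using rep.const[of x d 1] by simp
next
  case (Suc n)
  then show ?case using rep_mult[of x d 1 a f n] by simp
qed

lemma rep_sum:
  "finite S \<Longrightarrow> (\<And>i. i \<in> S \<Longrightarrow> rep x d n (a i) (f i)) \<Longrightarrow> rep x d n (sum a S) (\<lambda>l. \<Sum>i\<in>S. f i l)"
  by (induction S rule: finite_induct) (auto intro: rep.zero rep.add)

lemma rep_umbral:
  assumes "\<And>i. rep x d i (a i) (f i)" "rep x d 1 c g"
  shows "rep x d n (umbral a c n) (\<lambda>l. umbral (\<lambda>i. f i l) (g l) n)"
  unfolding umbral_def mult.assoc
proof (rule rep_sum)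
  fix i assume i: "i \<in> {..n}"
  have "rep x d (i + (n - i)) (a i * c ^ (n - i)) (\<lambda>l. f i l * g l ^ (n - i))"
    by (intro rep_mult rep_power assms)
  then show "rep x d n (of_nat (n choose i) * (a i * c ^ (n - i)))
      (\<lambda>l. of_nat (n choose i) * (f i l * g l ^ (n - i)))"
    using rep_smult[of x d n _ _ "of_nat (n choose i)"] i by (simp add: \<phi>_of_nat)
qed simp

lemma rep_mem: "rep x d n a f \<Longrightarrow> a \<in> elts (Gen (x ` {..<d}) ^ n)"
proof (induction rule: rep.induct)
  case (var n a f i)
  have "x i \<in> elts (Gen (x ` {..<d}))"
    using ideal_gen_superset[of "x ` {..<d}"] var.hyps(2) by (auto simp: elts_Gen)
  then show ?case using elts_timesI var.IH by simp
qed (auto simp: elts_one elts_rules)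

lemma rep_exists: "a \<in> elts (Gen (x ` {..<d}) ^ n) \<Longrightarrow> \<exists>f. rep x d n a f"
proof (induction n arbitrary: a)
  case 0
  show ?case using rep.const by blast
next
  case (Suc n)
  have step: "\<exists>f. rep x d (Suc n) a f"
    if "e \<le> d" "a \<in> elts (Gen (x ` {..<e}) * Gen (x ` {..<d}) ^ n)" for e a
    using that
  proof (induction e arbitrary: a)
    case 0
    then show ?case using rep.zero by (auto simp: Gen_empty elts_zero)
  next
    case (Suc e)
    have "Gen (x ` {..<Suc e}) * Gen (x ` {..<d}) ^ n =
        Gen (x ` {..<e}) * Gen (x ` {..<d}) ^ n + Gen (x ` {..<d}) ^ n * prin (x e)"
      unfolding lessThan_Suc image_insert Gen_insert distrib_right
      by (simp only: mult.commute add.commute)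
    then obtain a' r where "a' \<in> elts (Gen (x ` {..<e}) * Gen (x ` {..<d}) ^ n)"
      and r: "r \<in> elts (Gen (x ` {..<d}) ^ n)" and a: "a = a' + r * x e"
      using Suc.prems(2) by (auto simp: elts_plus elts_times_prin)
    then obtain f where "rep x d (Suc n) a' f" using Suc by auto
    moreover obtain g where "rep x d n r g" using \<open>\<And>a. a \<in> elts (Gen (x ` {..<d}) ^ n) \<Longrightarrow> \<exists>f. rep x d n a f\<close> r by blast
    then have "rep x d (Suc n) (x e * r) (\<lambda>l. l e * g l)" using Suc.prems(1) by (intro rep.var) auto
    ultimately show ?case unfolding a using rep.add by (metis mult.commute)
  qed
  show ?case using step[OF order_refl] Suc.prems by simp
qed

lemma rep_line:
  "rep x d n a f \<Longrightarrow> \<exists>p. degree p \<le> n \<and> (\<forall>t. f (\<lambda>i. l i + t * m i) = poly p t)"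
proof (induction rule: rep.induct)
  case (const a)
  then show ?case by (intro exI[of _ "[:\<phi> a:]"]) simp
next
  case (var n a f i)
  then obtain p where p: "degree p \<le> n" "\<And>t. f (\<lambda>i. l i + t * m i) = poly p t" by blast
  have "degree ([:l i, m i:] * p) \<le> degree [:l i, m i:] + degree p" by (rule degree_mult_le)
  also have "\<dots> \<le> Suc n" using p(1) by simp
  finally show ?case using p(2) by (intro exI[of _ "[:l i, m i:] * p"]) (auto simp: algebra_simps)
next
  case (zero n)
  then show ?case by (intro exI[of _ 0]) simp
next
  case (add n a f b g)
  then obtain p p' where "degree p \<le> n" "\<And>t. f (\<lambda>i. l i + t * m i) = poly p t"
    "degree p' \<le> n" "\<And>t. g (\<lambda>i. l i + t * m i) = poly p' t" by blast
  then show ?case by (intro exI[of _ "p + p'"]) (auto intro: degree_add_le)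
qed

lemma rep_homogeneous: "rep x d n a f \<Longrightarrow> f (\<lambda>i. t * l i) = t ^ n * f l"
  by (induction rule: rep.induct) (auto simp: distrib_left mult_ac)

lemma rep_cong: "rep x d n a f \<Longrightarrow> (\<And>i. i < d \<Longrightarrow> l i = l' i) \<Longrightarrow> f l = f l'"
  by (induction rule: rep.induct) auto

lemma rep_split_last:
  "rep x (Suc d) n a f \<Longrightarrow> \<exists>g F. (\<forall>i\<le>n. rep x d (n - i) (g i) (F i)) \<and>
    a = (\<Sum>i\<le>n. x d ^ i * g i) \<and> (\<forall>l. f l = (\<Sum>i\<le>n. l d ^ i * F i l))"
proof (induction rule: rep.induct)
  case (const a)
  show ?case
    by (intro exI[of _ "\<lambda>_. a"] exI[of _ "\<lambda>_ _. \<phi> a"]) (auto intro: rep.const)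
next
  case (var n a f i)
  then obtain g F where g: "\<And>i. i \<le> n \<Longrightarrow> rep x d (n - i) (g i) (F i)"
    and a: "a = (\<Sum>i\<le>n. x d ^ i * g i)" and f: "\<And>l. f l = (\<Sum>i\<le>n. l d ^ i * F i l)"
    by blast
  show ?case
  proof (cases "i = d")
    case True
    define g' F' where "g' j = (case j of 0 \<Rightarrow> 0 | Suc k \<Rightarrow> g k)"
      and "F' j = (case j of 0 \<Rightarrow> (\<lambda>_. 0) | Suc k \<Rightarrow> F k)" for j
    have "rep x d (Suc n - j) (g' j) (F' j)" if "j \<le> Suc n" for j
      using that g by (cases j) (auto simp: g'_def F'_def intro: rep.zero)
    moreover have "x i * a = (\<Sum>j\<le>Suc n. x d ^ j * g' j)"
      unfolding sum.atMost_Suc_shift True a by (simp add: g'_def sum_distrib_left mult.assoc)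
    moreover have "l i * f l = (\<Sum>j\<le>Suc n. l d ^ j * F' j l)" for l
      unfolding sum.atMost_Suc_shift True f by (simp add: F'_def sum_distrib_left mult.assoc)
    ultimately show ?thesis by blast
  next
    case False
    then have i: "i < d" using var.hyps by simp
    define g' F' where "g' j = (if j \<le> n then x i * g j else 0)"
      and "F' j = (if j \<le> n then (\<lambda>l. l i * F j l) else (\<lambda>_. 0))" for j
    have "rep x d (Suc n - j) (g' j) (F' j)" if "j \<le> Suc n" for j
      using that g i by (auto simp: g'_def F'_def Suc_diff_le intro: rep.zero rep.var)
    moreover have "x i * a = (\<Sum>j\<le>Suc n. x d ^ j * g' j)"
      unfolding a by (simp add: g'_def sum_distrib_left mult_ac)
    moreover have "l i * f l = (\<Sum>j\<le>Suc n. l d ^ j * F' j l)" for l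
      unfolding f by (simp add: F'_def sum_distrib_left mult_ac)
    ultimately show ?thesis by blast
  qed
next
  case (zero n)
  show ?case by (intro exI[of _ "\<lambda>_. 0"] exI[of _ "\<lambda>_ _. 0"]) (auto intro: rep.zero)
next
  case (add n a f b h)
  obtain g F where g: "\<And>i. i \<le> n \<Longrightarrow> rep x d (n - i) (g i) (F i)"
    "a = (\<Sum>i\<le>n. x d ^ i * g i)" "\<And>l. f l = (\<Sum>i\<le>n. l d ^ i * F i l)"
    using add.IH(1) by blast
  obtain g' F' where g': "\<And>i. i \<le> n \<Longrightarrow> rep x d (n - i) (g' i) (F' i)"
    "b = (\<Sum>i\<le>n. x d ^ i * g' i)" "\<And>l. h l = (\<Sum>i\<le>n. l d ^ i * F' i l)"
    using add.IH(2) by blast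
  show ?case
    using g g'
    by (intro exI[of _ "\<lambda>i. g i + g' i"] exI[of _ "\<lambda>i l. F i l + F' i l"])
      (auto intro: rep.add simp: distrib_left sum.distrib)
qed

lemma rep_no_vars: "rep x 0 n a f \<Longrightarrow> (if n = 0 then \<forall>l. f l = \<phi> a else a = 0)"
  by (induction rule: rep.induct) (auto split: if_splits)

lemma rep_vanishing:
  assumes "rep x d n a f" "\<And>l. f l = 0"
  shows "a \<in> elts (M * Gen (x ` {..<d}) ^ n)"
  using assms
proof (induction d arbitrary: n a f)
  case 0
  then show ?case using rep_no_vars[OF "0.prems"(1)]
    by (cases n) (auto simp: \<phi>_eq_0_iff[symmetric] elts_rules)
next
  case (Suc d)
  obtain g F where g: "\<And>i. i \<le> n \<Longrightarrow> rep x d (n - i) (g i) (F i)"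
    and a: "a = (\<Sum>i\<le>n. x d ^ i * g i)" and f: "\<And>l. f l = (\<Sum>i\<le>n. l d ^ i * F i l)"
    using rep_split_last[OF Suc.prems(1)] by blast
  have F0: "F i l = 0" if i: "i \<le> n" for i l
  proof -
    have "poly (\<Sum>i\<le>n. monom (F i l) i) t = 0" for t
    proof -
      have "F i (l(d := t)) = F i l" if "i \<le> n" for i
        by (rule rep_cong[OF g[OF that]]) auto
      then have "f (l(d := t)) = (\<Sum>i\<le>n. t ^ i * F i l)" unfolding f by simp
      then show ?thesis using Suc.prems(2) by (simp add: poly_sum poly_monom mult.commute)
    qed
    then have "(\<Sum>i\<le>n. monom (F i l) i) = 0"
      using poly_zero_infinite[OF infinite_k] by blast
    then have "coeff (\<Sum>i\<le>n. monom (F i l) i) i = 0" by simp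
    then show ?thesis using i by (simp add: coeff_sum)
  qed
  let ?G = "Gen (x ` {..<d})" and ?G' = "Gen (x ` {..<Suc d})"
  have "?G \<le> ?G'" using idl_le_plus(2)[of ?G "prin (x d)"] by (simp add: lessThan_Suc Gen_insert)
  have xd: "x d \<in> elts ?G'" using ideal_gen_superset[of "x ` {..<Suc d}"] by (auto simp: elts_Gen)
  have "x d ^ i * g i \<in> elts (M * ?G' ^ n)" if i: "i \<le> n" for i
  proof -
    have "g i \<in> elts (M * ?G ^ (n - i))" using Suc.IH[OF g[OF i]] F0[OF i] by blast
    then have "x d ^ i * g i \<in> elts (?G' ^ i * (M * ?G ^ (n - i)))"
      by (intro elts_timesI elts_powerI xd)
    also have "?G' ^ i * (M * ?G ^ (n - i)) \<le> ?G' ^ i * (M * ?G' ^ (n - i))"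
      by (intro idl_mult_mono idl_power_mono order_refl \<open>?G \<le> ?G'\<close>)
    also have "\<dots> = M * ?G' ^ n"
      using i by (simp add: mult.left_commute flip: power_add)
    finally show ?thesis .
  qed
  then show ?case unfolding a by (intro elts_sum) auto
qed

subsection \<open>Points of the fibre cone\<close>

text \<open>The component of degree \<open>n\<close> of the ideal generated in the Rees algebra of \<open>K\<close> by \<open>M\<close> in
  degree 0 and \<open>H\<close> in degree 1.\<close>
definition Q :: "'a idl \<Rightarrow> 'a idl \<Rightarrow> nat \<Rightarrow> 'a idl" where
  "Q K H n = M * K ^ n + (case n of 0 \<Rightarrow> 0 | Suc k \<Rightarrow> H * K ^ k)"

lemma Q_mult_le: "Q K H n * K ^ p \<le> Q K H (n + p)"
  by (cases n) (simp_all add: Q_def distrib_right distrib_left power_add mult_ac idl_le_plus(1))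

lemma Q_mono: "H \<le> H' \<Longrightarrow> Q K H n \<le> Q K H' n"
  by (cases n) (auto simp: Q_def intro!: add_left_mono idl_mult_mono)

lemma Q_plus: "Q K (H + prin e) n = Q K H n + (case n of 0 \<Rightarrow> 0 | Suc k \<Rightarrow> prin e * K ^ k)"
  by (cases n) (simp_all add: Q_def distrib_right add_ac)

lemma Q_M: "r \<in> elts M \<Longrightarrow> y \<in> elts (K ^ n) \<Longrightarrow> r * y \<in> elts (Q K H n)"
  unfolding Q_def by (intro elts_plusI1 elts_timesI)

lemma Q_H: "h \<in> elts H \<Longrightarrow> y \<in> elts (K ^ n) \<Longrightarrow> h * y \<in> elts (Q K H (Suc n))"
  unfolding Q_def by (intro elts_plusI2) (auto intro: elts_timesI)

lemma Q_mult: "y \<in> elts (Q K H n) \<Longrightarrow> z \<in> elts (K ^ p) \<Longrightarrow> y * z \<in> elts (Q K H (n + p))"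
  using Q_mult_le elts_timesI idl_leD by blast

lemma Q_cong_power:
  assumes "c \<in> elts K" "u \<in> elts K"
  shows "c ^ k * u ^ i - z ^ k * u ^ (i + k) \<in> elts (Q K (H + prin (c - z * u)) (i + k))"
proof (induction k)
  case (Suc k)
  let ?Q = "Q K (H + prin (c - z * u))"
  have "c ^ Suc k * u ^ i - z ^ Suc k * u ^ (i + Suc k) =
      (c ^ k * u ^ i - z ^ k * u ^ (i + k)) * c ^ 1 + z ^ k * ((c - z * u) * u ^ (i + k))"
    by (simp add: algebra_simps)
  moreover have "(c ^ k * u ^ i - z ^ k * u ^ (i + k)) * c ^ 1 \<in> elts (?Q (i + k + 1))"
    by (intro Q_mult Suc.IH elts_powerI assms)
  moreover have "z ^ k * ((c - z * u) * u ^ (i + k)) \<in> elts (?Q (Suc (i + k)))"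
    by (intro elts_rules(3) Q_H elts_powerI assms elts_plusI2 prin_self)
  ultimately show ?case by (simp add: elts_rules)
qed (simp add: elts_rules)

definition hom :: "'a \<Rightarrow> 'a \<Rightarrow> nat \<Rightarrow> 'a poly \<Rightarrow> 'a" where
  "hom c u r g = (\<Sum>i\<le>r. coeff g i * c ^ i * u ^ (r - i))"

lemma hom_add: "hom c u r (g + h) = hom c u r g + hom c u r h"
  by (simp add: hom_def distrib_right sum.distrib)

lemma hom_sum: "hom c u r (sum g S) = (\<Sum>i\<in>S. hom c u r (g i))"
proof (induction S rule: infinite_finite_induct)
  case (insert x S)
  then show ?case by (simp add: hom_add)
qed (simp_all add: hom_def)

lemma hom_monom: "k \<le> r \<Longrightarrow> hom c u r (monom z k) = z * c ^ k * u ^ (r - k)"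
  unfolding hom_def by (subst sum.mono_neutral_right[of _ "{k}"]) auto

lemma hom_linear_mult:
  assumes "degree h \<le> r"
  shows "hom c u (Suc r) ([:- z, 1:] * h) = (c - z * u) * hom c u r h"
proof -
  have "hom c u (Suc r) ([:- z, 1:] * h) =
      hom c u (Suc r) (pCons 0 h) + hom c u (Suc r) (smult (- z) h)"
    by (simp add: add.commute flip: hom_add)
  also have "hom c u (Suc r) (pCons 0 h) = c * hom c u r h"
    unfolding hom_def sum.atMost_Suc_shift by (simp add: sum_distrib_left mult_ac)
  also have "hom c u (Suc r) (smult (- z) h) = - (z * u) * hom c u r h"
    using assms unfolding hom_def
    by (simp add: coeff_eq_0 sum_distrib_left Suc_diff_le mult_ac sum_negf)
  finally show ?thesis by (simp add: algebra_simps)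
qed

lemma hom_mem:
  assumes "c \<in> elts K" "u \<in> elts K"
  shows "hom c u r g \<in> elts (K ^ r)"
  unfolding hom_def mult.assoc
proof (rule elts_sum, rule elts_rules(3))
  fix i assume i: "i \<in> {..r}"
  have "c ^ i * u ^ (r - i) \<in> elts (K ^ i * K ^ (r - i))"
    using assms by (intro elts_timesI elts_powerI)
  then show "c ^ i * u ^ (r - i) \<in> elts (K ^ r)" using i by (simp flip: power_add)
qed

text \<open>A zero of a monic form is split off repeatedly until the point avoids \<open>u = 0\<close>.\<close>
lemma exists_point:
  assumes c: "c \<in> elts K" and u: "u \<in> elts K"
    and avoid: "\<And>N. u ^ N \<notin> elts (Q K H N)"
    and "degree g \<le> r" "coeff g r = 1" "hom c u r g * u ^ N \<in> elts (Q K H (r + N))"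
  shows "\<exists>z. \<forall>N. u ^ N \<notin> elts (Q K (H + prin (c - z * u)) N)"
  using assms(4-)
proof (induction r arbitrary: g N)
  case 0
  then show ?case using avoid[of N] by (simp add: hom_def)
next
  case (Suc r)
  obtain z where z: "poly g z \<in> elts M" using monic_root[OF Suc.prems(1,2)] by auto
  define h where "h = synthetic_div g z"
  have g: "g = [:- z, 1:] * h + [:poly g z:]" unfolding h_def by (simp only: synthetic_div_correct')
  have h: "degree h \<le> r" using Suc.prems(1) by (simp add: h_def degree_synthetic_div)
  have "coeff h (Suc r) = 0" using h by (simp add: coeff_eq_0)
  then have h1: "coeff h r = 1" using Suc.prems(2) by (subst (asm) g) simp
  define e where "e = c - z * u"
  show ?case
  proof (cases "\<forall>N. u ^ N \<notin> elts (Q K (H + prin e) N)")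
    case True
    then show ?thesis unfolding e_def by blast
  next
    case False
    then obtain N' where N': "u ^ N' \<in> elts (Q K (H + prin e) N')" by blast
    define y where "y = hom c u r h * u ^ N"
    have y: "y \<in> elts (K ^ (r + N))"
      unfolding y_def power_add by (intro elts_timesI hom_mem elts_powerI c u)
    have "hom c u (Suc r) g = e * hom c u r h + poly g z * u ^ Suc r"
      by (subst g, subst hom_add, subst hom_linear_mult[OF h])
        (simp add: e_def hom_monom flip: monom_0)
    then have "e * y = hom c u (Suc r) g * u ^ N - poly g z * u ^ (Suc r + N)"
      by (simp add: y_def algebra_simps power_add)
    also have "\<dots> \<in> elts (Q K H (Suc r + N))"
      by (intro elts_diff Suc.prems Q_M z elts_powerI u)
    finally have ey: "e * y \<in> elts (Q K H (Suc r + N))" .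
    have "y * u ^ N' \<in> elts (Q K H (r + N + N'))"
    proof -
      obtain v w where v: "v \<in> elts (Q K H N')"
        and w: "w \<in> elts (case N' of 0 \<Rightarrow> 0 | Suc k \<Rightarrow> prin e * K ^ k)" and uv: "u ^ N' = v + w"
        using N' unfolding Q_plus elts_plus by blast
      have "y * w \<in> elts (Q K H (r + N + N'))"
      proof (cases N')
        case 0
        then show ?thesis using w by (simp add: elts_zero elts_rules)
      next
        case (Suc k)
        then obtain s where "s \<in> elts (K ^ k)" "w = s * e"
          using w elts_times_prin[of w "K ^ k" e] by (auto simp: mult.commute)
        then show ?thesis using Q_mult[OF ey, of s k] Suc by (simp add: mult_ac add_ac)
      qed
      moreover have "y * v \<in> elts (Q K H (r + N + N'))"
        using Q_mult[OF v y] by (simp add: mult.commute add.commute)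
      ultimately show ?thesis unfolding uv by (simp add: distrib_left elts_rules)
    qed
    then have "hom c u r h * u ^ (N + N') \<in> elts (Q K H (r + (N + N')))"
      by (simp add: y_def power_add mult_ac add_ac)
    then show ?thesis by (rule Suc.IH[OF h h1])
  qed
qed

end

locale minimal_generators = local_residue \<phi> M
  for \<phi> :: "'a::comm_ring_1 \<Rightarrow> 'k::field" and M :: "'a idl" +
  fixes J :: "'a idl" and x :: "nat \<Rightarrow> 'a" and d :: nat
  assumes J_eq: "J = Gen (x ` {..<d})"
    and d_least: "finite T \<Longrightarrow> J = Gen T \<Longrightarrow> d \<le> card T"
    and no_proper_red: "red J' J \<Longrightarrow> J' = J"
begin

text \<open>The linear forms vanishing at the point with homogeneous coordinates \<open>\<phi> (L j)\<close>.\<close>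
definition H :: "(nat \<Rightarrow> 'a) \<Rightarrow> nat \<Rightarrow> 'a idl" where
  "H L i0 = Gen ((\<lambda>j. L i0 * x j - L j * x i0) ` ({..<d} - {i0}))"

lemma x_mem: "i < d \<Longrightarrow> x i \<in> elts J"
  using ideal_gen_superset[of "x ` {..<d}"] by (auto simp: J_eq elts_Gen)

lemma H_mem: "j < d \<Longrightarrow> L i0 * x j - L j * x i0 \<in> elts (H L i0)"
  using ideal_gen_superset[of "(\<lambda>j. L i0 * x j - L j * x i0) ` ({..<d} - {i0})"]
  by (cases "j = i0") (auto simp: H_def elts_Gen elts_rules simp flip: elts_Gen)

lemma H_le: "i0 < d \<Longrightarrow> H L i0 \<le> J"
  unfolding H_def Gen_le_iff by (auto intro!: elts_diff elts_rules(3) x_mem)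

lemma J_le_H:
  assumes "i0 < d" "L i0 \<notin> elts M"
  shows "J \<le> H L i0 + prin (x i0)"
  unfolding J_eq Gen_le_iff
proof clarify
  fix j assume j: "j < d"
  obtain v where v: "v * L i0 = 1" using local_unit[OF loc assms(2)] by blast
  have "x j = (v * L i0) * x j" using v by simp
  also have "\<dots> = v * (L i0 * x j - L j * x i0) + (v * L j) * x i0"
    by (simp add: algebra_simps)
  finally have "x j = v * (L i0 * x j - L j * x i0) + (v * L j) * x i0" .
  moreover have "v * (L i0 * x j - L j * x i0) \<in> elts (H L i0)"
    by (intro elts_rules(3) H_mem j)
  moreover have "(v * L j) * x i0 \<in> elts (prin (x i0))" by (intro elts_rules(3) prin_self)
  ultimately show "x j \<in> elts (H L i0 + prin (x i0))" by (auto simp: elts_plus)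
qed

lemma H_not_red:
  assumes "i0 < d"
  shows "\<not> red (H L i0) J"
proof
  assume "red (H L i0) J"
  then have "J = H L i0" using no_proper_red[of "H L i0"] by simp
  then have "d \<le> card ((\<lambda>j. L i0 * x j - L j * x i0) ` ({..<d} - {i0}))"
    unfolding H_def by (intro d_least) auto
  also have "\<dots> \<le> card ({..<d} - {i0})" by (rule card_image_le) simp
  finally show False using assms by simp
qed

lemma power_avoids_Q:
  assumes i0: "i0 < d" and L: "L i0 \<notin> elts M" and K: "red J K"
  shows "x i0 ^ N \<notin> elts (Q K (H L i0) N)"
proof
  let ?H = "H L i0" and ?u = "x i0"
  have JK: "J \<le> K" using K by (simp add: red_def)
  have u: "?u \<in> elts K" using x_mem[OF i0] JK by (rule idl_leD[rotated])
  assume "?u ^ N \<in> elts (Q K ?H N)"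
  then have "?u ^ N * ?u ^ 1 \<in> elts (Q K ?H (N + 1))" by (rule Q_mult) (simp add: u)
  then have A: "prin ?u ^ Suc N \<le> M * K ^ Suc N + ?H * K ^ N"
    by (simp add: Q_def mult.commute flip: prin_le_iff prin_power prin_mult)
  have B: "?H * J ^ N \<le> M * K ^ Suc N + ?H * K ^ N"
    by (rule order_trans[OF _ idl_le_plus(2)]) (intro idl_mult_mono idl_power_mono JK order_refl)
  have J: "J = ?H + prin ?u"
    using J_le_H[of i0 L] H_le[OF i0] x_mem[OF i0] i0 L
    by (intro antisym idl_plus_le) (auto simp: prin_le_iff)
  have S: "J ^ Suc N = prin ?u ^ Suc N + ?H * J ^ N"
    using idl_power_plus_Suc[of ?H "prin ?u" N] unfolding J[symmetric] .
  have JN: "J ^ Suc N \<le> M * K ^ Suc N + ?H * K ^ N"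
    unfolding S using A B by (rule idl_plus_le)
  obtain r where r: "\<forall>s. K ^ (s + r) \<le> J ^ s * K ^ r" using K by (rule red_powerE)
  have "K ^ (Suc N + r) \<le> J ^ Suc N * K ^ r" using r by blast
  also have "\<dots> \<le> (M * K ^ Suc N + ?H * K ^ N) * K ^ r" by (intro idl_mult_mono JN order_refl)
  also have "\<dots> = ?H * K ^ (N + r) + M * K ^ (Suc N + r)"
    by (simp add: distrib_right distrib_left power_add mult_ac add.commute)
  finally have "K ^ (Suc N + r) \<le> ?H * K ^ (N + r)" by (rule nakayama[OF noeth loc])
  then have "red ?H K" using H_le[OF i0] JK unfolding red_def by (auto intro: order_trans)
  then have "red ?H J"
    using red_imp_integral[OF noeth] JK
    by (intro integral_imp_red[OF noeth] H_le i0) (auto simp: int_closure_iff_red less_eq_idl_def)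
  then show False using H_not_red[OF i0] by blast
qed

lemma rep_point:
  assumes "rep x d n a f" and L: "\<And>i. \<phi> (L i) = l i" and i0: "i0 < d" and JK: "J \<le> K"
  shows "\<exists>F. \<phi> F = f l \<and> L i0 ^ n * a - F * x i0 ^ n \<in> elts (Q K (H L i0) n)"
  using assms(1)
proof (induction rule: rep.induct)
  case (const a)
  show ?case by (intro exI[of _ a]) (simp add: elts_rules)
next
  case (var n a f i)
  then obtain F where F: "\<phi> F = f l" "L i0 ^ n * a - F * x i0 ^ n \<in> elts (Q K (H L i0) n)" by blast
  have u: "x i0 \<in> elts (K ^ 1)" using x_mem[OF i0] JK by (simp add: less_eq_idl_def subsetD)
  have "a \<in> elts (K ^ n)"
    using rep_mem[OF var.hyps(1)] idl_power_mono[OF JK] by (auto simp: J_eq[symmetric] less_eq_idl_def)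
  then have "(L i0 * x i - L i * x i0) * (L i0 ^ n * a) \<in> elts (Q K (H L i0) (Suc n))"
    by (intro Q_H H_mem var.hyps elts_rules(3))
  moreover have "(L i0 ^ n * a - F * x i0 ^ n) * x i0 \<in> elts (Q K (H L i0) (n + 1))"
    by (rule Q_mult[OF F(2) u])
  then have "L i * ((L i0 ^ n * a - F * x i0 ^ n) * x i0) \<in> elts (Q K (H L i0) (Suc n))"
    by (simp add: elts_rules)
  ultimately have "(L i0 * x i - L i * x i0) * (L i0 ^ n * a) +
      L i * ((L i0 ^ n * a - F * x i0 ^ n) * x i0) \<in> elts (Q K (H L i0) (Suc n))"
    by (rule elts_rules(2))
  then have "L i0 ^ Suc n * (x i * a) - (L i * F) * x i0 ^ Suc n \<in> elts (Q K (H L i0) (Suc n))"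
    by (simp add: algebra_simps)
  then show ?case using F(1) L by (intro exI[of _ "L i * F"]) simp
next
  case (zero n)
  show ?case by (intro exI[of _ 0]) (simp add: elts_rules)
next
  case (add n a f b g)
  then obtain F G where "\<phi> F = f l" "L i0 ^ n * a - F * x i0 ^ n \<in> elts (Q K (H L i0) n)"
    "\<phi> G = g l" "L i0 ^ n * b - G * x i0 ^ n \<in> elts (Q K (H L i0) n)" by blast
  then show ?case
    using elts_rules(2)[of "L i0 ^ n * a - F * x i0 ^ n" _ "L i0 ^ n * b - G * x i0 ^ n"]
    by (intro exI[of _ "F + G"]) (simp add: algebra_simps)
qed

lemma wroot_exists:
  assumes a0: "a 0 = 1" and zero: "\<And>n. n \<in> {q+1..2*q+1} \<Longrightarrow> umbral a b n = 0"
    and f0: "f 0 = (\<lambda>_. 1)" and rep: "\<And>i. rep x d i (a i) (f i)" and red: "red J (J + prin b)"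
  shows "\<exists>y. wroot q (\<lambda>i. f i l) y"
proof (cases "\<forall>i<d. l i = 0")
  case True
  have "f i l = f i (\<lambda>j. 0 * l j)" for i using True by (intro rep_cong[OF rep]) auto
  then have "f i l = 0 ^ i * f i l" for i using rep_homogeneous[OF rep, of i 0 l] by metis
  then have "f i l = 0" if "i > 0" for i using that by (metis mult_zero_left zero_power)
  then have "wroot q (\<lambda>i. f i l) 0" by (simp add: wroot_def umbral_zero_arg)
  then show ?thesis ..
next
  case False
  then obtain i0 where i0: "i0 < d" "l i0 \<noteq> 0" by blast
  define L where "L i = inv \<phi> (l i)" for i
  have L: "\<phi> (L i) = l i" for i unfolding L_def by (rule surj_f_inv_f[OF surj_\<phi>])
  define w u c where "w = L i0" and "u = x i0" and "c = w * b"
  have w: "w \<notin> elts M" using i0 L by (simp add: w_def flip: \<phi>_eq_0_iff)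
  define K where "K = J + prin c"
  let ?H = "H L i0"
  have JK: "J \<le> K" by (simp add: K_def idl_le_plus)
  have cK: "c \<in> elts K" by (simp add: K_def elts_plusI2)
  have uK: "u \<in> elts K" using x_mem[OF i0(1)] JK by (auto simp: u_def less_eq_idl_def)
  have "red J K"
    unfolding K_def using red by (rule red_imp_integral[OF noeth]) (simp add: c_def elts_plusI2 elts_rules)
  have avoid: "u ^ N \<notin> elts (Q K ?H N)" for N
    unfolding u_def using i0(1) w \<open>red J K\<close> by (intro power_avoids_Q) (auto simp: w_def)
  have "\<exists>F. \<phi> F = f i l \<and> w ^ i * a i - F * u ^ i \<in> elts (Q K ?H i)" for i
    unfolding w_def u_def by (rule rep_point[OF rep L i0(1) JK])
  then obtain F' where F': "\<And>i. \<phi> (F' i) = f i l" "\<And>i. w ^ i * a i - F' i * u ^ i \<in> elts (Q K ?H i)"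
    by metis
  define F where "F = F'(0 := 1)"
  have F0: "F 0 = 1" by (simp add: F_def)
  have \<phi>F: "\<phi> (F i) = f i l" for i using F'(1) f0 by (simp add: F_def)
  have F: "w ^ i * a i - F i * u ^ i \<in> elts (Q K ?H i)" for i
    using F'(2)[of i] a0 by (simp add: F_def elts_rules)
  have sum_mem: "(\<Sum>i\<le>n. of_nat (n choose i) * (F i * (c ^ (n - i) * u ^ i))) \<in> elts (Q K ?H n)"
    if n: "n \<in> {q+1..2*q+1}" for n
  proof -
    have "umbral (\<lambda>i. w ^ i * a i) c n = 0"
      unfolding c_def umbral_scale using zero[OF n] by simp
    then have "(\<Sum>i\<le>n. of_nat (n choose i) * (F i * (c ^ (n - i) * u ^ i))) =
        - (\<Sum>i\<le>n. of_nat (n choose i) * ((w ^ i * a i - F i * u ^ i) * c ^ (n - i)))"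
      by (simp add: umbral_def algebra_simps sum_subtractf)
    also have "\<dots> \<in> elts (Q K ?H n)"
    proof (rule elts_uminus, rule elts_sum, rule elts_rules(3))
      fix i assume "i \<in> {..n}"
      then show "(w ^ i * a i - F i * u ^ i) * c ^ (n - i) \<in> elts (Q K ?H n)"
        using Q_mult[OF F elts_powerI[OF cK, of "n - i"], of i] by simp
    qed
    finally show ?thesis .
  qed
  define p where "p = 2*q+1"
  define g where "g = (\<Sum>i\<le>p. monom (of_nat (p choose i) * F i) (p - i))"
  have "degree g \<le> p"
    unfolding g_def by (intro degree_sum_le) (auto intro: order_trans[OF degree_monom_le])
  moreover have "coeff g p = 1"
  proof -
    have "coeff g p = (\<Sum>i\<le>p. if i = 0 then of_nat (p choose i) * F i else 0)"
      unfolding g_def coeff_sum by (intro sum.cong) auto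
    then show ?thesis using F0 by simp
  qed
  moreover have "hom c u p g = (\<Sum>i\<le>p. of_nat (p choose i) * (F i * (c ^ (p - i) * u ^ i)))"
    unfolding g_def hom_sum by (intro sum.cong) (auto simp: hom_monom mult_ac)
  then have "hom c u p g * u ^ 0 \<in> elts (Q K ?H (p + 0))"
    using sum_mem[of p] by (simp add: p_def)
  ultimately obtain z where z: "\<And>N. u ^ N \<notin> elts (Q K (?H + prin (c - z * u)) N)"
    using exists_point[OF cK uK avoid] by blast
  have "umbral (\<lambda>i. f i l) (\<phi> z) n = 0" if n: "n \<in> {q+1..2*q+1}" for n
  proof -
    let ?Q = "Q K (?H + prin (c - z * u)) n"
    have "of_nat (n choose i) * (F i * (c ^ (n - i) * u ^ i - z ^ (n - i) * u ^ n)) \<in> elts ?Q"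
      if "i \<le> n" for i
      using Q_cong_power[OF cK uK, of "n - i" i z ?H] that by (simp add: elts_rules)
    then have "(\<Sum>i\<le>n. of_nat (n choose i) * (F i * (c ^ (n - i) * u ^ i - z ^ (n - i) * u ^ n))) \<in> elts ?Q"
      by (intro elts_sum) simp
    moreover have "(\<Sum>i\<le>n. of_nat (n choose i) * (F i * (c ^ (n - i) * u ^ i))) \<in> elts ?Q"
      using sum_mem[OF n] Q_mono[OF idl_le_plus(1)] by (rule idl_leD[rotated])
    moreover have alg: "C * A * Z * U = C * (A * X) - C * (A * (X - Z * U))" for C A X Z U :: 'a
      by (simp add: algebra_simps)
    have "umbral F z n * u ^ n =
        (\<Sum>i\<le>n. of_nat (n choose i) * (F i * (c ^ (n - i) * u ^ i))) -
        (\<Sum>i\<le>n. of_nat (n choose i) * (F i * (c ^ (n - i) * u ^ i - z ^ (n - i) * u ^ n)))"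
      unfolding umbral_def sum_distrib_right sum_subtractf[symmetric]
      by (rule sum.cong[OF refl]) (rule alg)
    ultimately have mem: "umbral F z n * u ^ n \<in> elts ?Q" by (simp only: elts_diff)
    have "umbral F z n \<in> elts M"
    proof (rule ccontr)
      assume "umbral F z n \<notin> elts M"
      then obtain v where "v * umbral F z n = 1" using local_unit[OF loc] by blast
      then have "v * (umbral F z n * u ^ n) = u ^ n" by (simp flip: mult.assoc)
      then show False using z[of n] elts_rules(3)[OF mem, of v] by simp
    qed
    then show ?thesis by (simp flip: \<phi>_eq_0_iff add: \<phi>_umbral \<phi>F)
  qed
  then show ?thesis unfolding wroot_def by blast
qed

lemma wroot_additive:
  assumes rep: "\<And>i. rep x d i (a i) (f i)" and f0: "f 0 = (\<lambda>_. 1)"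
    and \<beta>: "\<And>l. wroot q (\<lambda>i. f i l) (\<beta> l)"
  shows "\<beta> (\<lambda>i. t * l i) = t * \<beta> l" and "\<beta> (\<lambda>i. l i + m i) = \<beta> l + \<beta> m"
proof -
  have scale: "\<beta> (\<lambda>i. t * l i) = t * \<beta> l" for t l
  proof (rule wroot_unique[OF _ \<beta>])
    show "f 0 (\<lambda>i. t * l i) = 1" by (simp add: f0)
    show "wroot q (\<lambda>i. f i (\<lambda>j. t * l j)) (t * \<beta> l)"
      using wroot_scale[OF \<beta>[of l], of t] by (simp add: rep_homogeneous[OF rep])
  qed
  then show "\<beta> (\<lambda>i. t * l i) = t * \<beta> l" .
  have line: "\<exists>e. \<forall>t. \<beta> (\<lambda>i. l i + t * m i) = \<beta> l + e * t" for l m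
  proof -
    have "\<exists>p. degree p \<le> i \<and> (\<forall>t. f i (\<lambda>j. l j + t * m j) = poly p t)" for i
      by (rule rep_line[OF rep])
    then obtain \<alpha>' where \<alpha>': "\<And>i. degree (\<alpha>' i) \<le> i"
      "\<And>i t. f i (\<lambda>j. l j + t * m j) = poly (\<alpha>' i) t" by metis
    define \<alpha> where "\<alpha> = \<alpha>'(0 := 1)"
    have \<alpha>: "degree (\<alpha> i) \<le> i" "poly (\<alpha> i) t = f i (\<lambda>j. l j + t * m j)" for i t
      using \<alpha>'(1) by (simp_all add: \<alpha>_def f0 flip: \<alpha>'(2))
    have "\<exists>c e. \<forall>t. \<beta> (\<lambda>j. l j + t * m j) = c + e * t"
    proof (rule wroot_linear)
      show "\<alpha> 0 = 1" by (simp add: \<alpha>_def)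
      show "wroot q (\<lambda>i. poly (\<alpha> i) t) (\<beta> (\<lambda>j. l j + t * m j))" for t
        unfolding \<alpha>(2) by (rule \<beta>)
    qed (use of_nat_nonzero infinite_k k_root \<alpha>(1) in auto)
    then obtain c e where ce: "\<And>t. \<beta> (\<lambda>j. l j + t * m j) = c + e * t" by blast
    then show ?thesis using ce[of 0] by auto
  qed
  obtain e where e: "\<And>t. \<beta> (\<lambda>i. l i + t * m i) = \<beta> l + e * t" using line by blast
  obtain e' where e': "\<And>t. \<beta> (\<lambda>i. m i + t * l i) = \<beta> m + e' * t" using line by blast
  have eq: "\<beta> l + e * t = \<beta> m * t + e'" if "t \<noteq> 0" for t
  proof -
    have "(\<lambda>i. l i + t * m i) = (\<lambda>i. t * (m i + inverse t * l i))"
      using that by (simp add: distrib_left flip: mult.assoc) (simp add: add.commute)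
    then have "\<beta> l + e * t = t * (\<beta> m + e' * inverse t)" using scale e e' by metis
    also have "\<dots> = \<beta> m * t + e'" using that by (simp add: distrib_left mult.commute)
    finally show ?thesis .
  qed
  have "of_nat 2 \<noteq> (0 :: 'k)" by (rule of_nat_nonzero) simp
  then have "(2 :: 'k) \<noteq> 0" by simp
  then have "\<beta> l + e * 2 = \<beta> m * 2 + e'" by (rule eq)
  moreover have "\<beta> l + e = \<beta> m + e'" using eq[of 1] by simp
  moreover have "e = (\<beta> l + e * 2) - (\<beta> l + e)" "\<beta> m = (\<beta> m * 2 + e') - (\<beta> m + e')"
    by (simp_all add: mult_2_right)
  ultimately have "e = \<beta> m" by simp
  then show "\<beta> (\<lambda>i. l i + m i) = \<beta> l + \<beta> m" using e[of 1] by simp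
qed

lemma wroot_linear_form:
  assumes rep: "\<And>i. rep x d i (a i) (f i)" and f0: "f 0 = (\<lambda>_. 1)"
    and \<beta>: "\<And>l. wroot q (\<lambda>i. f i l) (\<beta> l)"
  shows "\<exists>j\<in>elts J. rep x d 1 j \<beta>"
proof -
  define \<delta> :: "nat \<Rightarrow> nat \<Rightarrow> 'k" where "\<delta> k i = (if i = k then 1 else 0)" for k i
  have trunc: "\<beta> (\<lambda>i. if i < k then l i else 0) = (\<Sum>i<k. l i * \<beta> (\<delta> i))" for k l
  proof (induction k)
    case 0
    show ?case using wroot_additive(1)[OF rep f0 \<beta>, of 0 "\<lambda>_. 0"] by simp
  next
    case (Suc k)
    have "(\<lambda>i. if i < Suc k then l i else 0) = (\<lambda>i. (if i < k then l i else 0) + l k * \<delta> k i)"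
      by (auto simp: \<delta>_def less_Suc_eq)
    then show ?case
      using wroot_additive(2)[OF rep f0 \<beta>, of "\<lambda>i. if i < k then l i else 0" "\<lambda>i. l k * \<delta> k i"]
        wroot_additive(1)[OF rep f0 \<beta>, of "l k" "\<delta> k"] Suc by simp
  qed
  have sum: "\<beta> l = (\<Sum>i<d. l i * \<beta> (\<delta> i))" for l
  proof -
    have "f n l = f n (\<lambda>i. if i < d then l i else 0)" for n by (rule rep_cong[OF rep]) simp
    then have "wroot q (\<lambda>i. f i l) (\<beta> (\<lambda>i. if i < d then l i else 0))"
      using \<beta>[of "\<lambda>i. if i < d then l i else 0"] by simp
    then show ?thesis using wroot_unique[of "\<lambda>i. f i l"] \<beta>[of l] trunc f0 by metis
  qed
  define B where "B i = inv \<phi> (\<beta> (\<delta> i))" for i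
  have B: "\<phi> (B i) = \<beta> (\<delta> i)" for i unfolding B_def by (rule surj_f_inv_f[OF surj_\<phi>])
  have "rep x d 1 (\<Sum>i<d. x i * B i) (\<lambda>l. \<Sum>i<d. l i * \<beta> (\<delta> i))"
  proof (rule rep_sum)
    show "rep x d 1 (x i * B i) (\<lambda>l. l i * \<beta> (\<delta> i))" if "i \<in> {..<d}" for i
      using rep.var[OF rep.const[of x d "B i"], of i] that by (simp add: B)
  qed simp
  moreover have "(\<lambda>l. \<Sum>i<d. l i * \<beta> (\<delta> i)) = \<beta>" by (rule ext) (rule sum[symmetric])
  moreover have "(\<Sum>i<d. x i * B i) \<in> elts J"
    by (intro elts_sum elts_rules(4) x_mem) simp
  ultimately show ?thesis by auto
qed

lemma weak_subint_closure_decompose: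
  assumes b: "b \<in> weak_subint_closure (elts J)" and MJ: "M ^ t \<le> J"
  shows "\<exists>j\<in>elts J. b - j \<in> I_gt (elts J)"
proof -
  obtain q a where a0: "a 0 = 1" and aJ: "\<And>i. a i \<in> elts (J ^ i)"
    and zero: "\<And>n. n \<in> {q+1..2*q+1} \<Longrightarrow> umbral a b n = 0"
    using b unfolding weak_subint_closure_iff by blast
  define p where "p = 2*q+1"
  have "b \<in> int_closure (elts J)"
    unfolding int_closure_def mem_Collect_eq elts_ideal_pow[symmetric]
  proof (intro exI conjI ballI)
    show "1 \<le> p" by (simp add: p_def)
    show "of_nat (p choose i) * a i \<in> elts (J ^ i)" for i by (intro elts_rules(3) aJ)
    have "umbral a b p = 0" using zero[of p] by (simp add: p_def)
    then show "b ^ p + (\<Sum>i=1..p. of_nat (p choose i) * a i * b ^ (p - i)) = 0"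
      by (simp add: umbral_def atMost_atLeast0 sum.atLeast_Suc_atMost a0)
  qed
  then have red: "red J (J + prin b)" by (simp add: int_closure_iff_red)
  have "\<exists>f. rep x d i (a i) f" for i using rep_exists aJ J_eq by blast
  then obtain f' where f': "\<And>i. rep x d i (a i) (f' i)" by metis
  define f where "f = f'(0 := (\<lambda>_. 1))"
  have rep: "rep x d i (a i) (f i)" for i
    using f'[of i] rep.const[of x d 1] a0 by (auto simp: f_def)
  have f0: "f 0 = (\<lambda>_. 1)" by (simp add: f_def)
  have "\<exists>y. wroot q (\<lambda>i. f i l) y" for l
    by (rule wroot_exists[OF a0 zero f0 rep red])
  then obtain \<beta> where \<beta>: "\<And>l. wroot q (\<lambda>i. f i l) (\<beta> l)" by metis
  obtain j where j: "j \<in> elts J" and rj: "rep x d 1 j \<beta>"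
    using wroot_linear_form[OF rep f0 \<beta>] by blast
  define c where "c = b - j"
  define K where "K = J + prin c"
  have JK: "J \<le> K" and cK: "c \<in> elts K" by (auto simp: K_def idl_le_plus elts_plusI2)
  have "c ^ p \<in> elts (M * K ^ p)"
    unfolding p_def
  proof (rule power_mem_of_umbral)
    show "umbral a j 0 = 1" by (simp add: a0)
    show "umbral (umbral a j) c n = 0" if "n \<in> {q+1..2*q+1}" for n
      using zero[OF that] by (simp add: umbral_umbral c_def)
    fix i assume i: "i \<in> {q+1..2*q+1}"
    have "umbral a j i \<in> elts (M * J ^ i)"
      unfolding J_eq using \<beta> i
      by (intro rep_vanishing[OF rep_umbral[OF rep rj]]) (auto simp: wroot_def)
    then have "umbral a j i * c ^ (2*q+1-i) \<in> elts ((M * J ^ i) * K ^ (2*q+1-i))"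
      by (intro elts_timesI elts_powerI cK)
    also have "(M * J ^ i) * K ^ (2*q+1-i) \<le> (M * K ^ i) * K ^ (2*q+1-i)"
      by (intro idl_mult_mono idl_power_mono JK order_refl)
    also have "\<dots> = M * K ^ (2*q+1)" using i by (simp add: mult.assoc flip: power_add power_Suc)
    finally show "umbral a j i * c ^ (2*q+1-i) \<in> elts (M * K ^ (2*q+1))" .
  qed
  moreover have "red J K"
    unfolding K_def using red
    by (rule red_imp_integral[OF noeth])
      (unfold c_def, intro elts_diff elts_plusI1[OF j] elts_plusI2 prin_self)
  then obtain r where r: "\<forall>s. K ^ (s + r) \<le> J ^ s * K ^ r" by (rule red_powerE)
  define T where "T = Suc t * Suc r"
  have pT: "p * T = (p * T - r) + r" "p * T \<ge> 1"
  proof -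
    have "1 * (1 * r) \<le> p * (Suc t * Suc r)" by (intro mult_le_mono) (auto simp: p_def)
    then show "p * T = (p * T - r) + r" by (simp add: T_def)
    show "p * T \<ge> 1" by (simp add: p_def T_def)
  qed
  ultimately have "(c ^ p) ^ T \<in> elts ((M * K ^ p) ^ T)" by (intro elts_powerI)
  also have "(M * K ^ p) ^ T = M ^ T * K ^ (p * T)" by (simp add: power_mult_distrib power_mult)
  also have "\<dots> \<le> J ^ Suc r * J ^ (p * T - r)"
  proof (rule idl_mult_mono)
    have "M ^ Suc t \<le> J" using MJ idl_mult_le(2)[of M "M ^ t"] by simp
    then show "M ^ T \<le> J ^ Suc r" unfolding T_def power_mult by (rule idl_power_mono)
    show "K ^ (p * T) \<le> J ^ (p * T - r)"
      by (subst pT(1)) (rule order_trans[OF r[rule_format] idl_mult_le(1)])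
  qed
  also have "\<dots> = J ^ Suc (p * T)"
    using pT(1) by (metis add.commute add_Suc power_add)
  finally have "c ^ (p * T) \<in> elts (J ^ Suc (p * T))" by (simp add: power_mult)
  then have "c \<in> I_gt (elts J)" unfolding I_gt_iff using pT(2) by blast
  then show ?thesis unfolding c_def using j by blast
qed

end

subsection \<open>The residue field\<close>

definition maximal_ideal :: "'a::comm_ring_1 set \<Rightarrow> bool" where
  "maximal_ideal M \<longleftrightarrow> is_ideal M \<and> 1 \<notin> M \<and> (\<forall>I. is_ideal I \<and> 1 \<notin> I \<and> M \<subseteq> I \<longrightarrow> I = M)"

lemma is_ideal_UNIV_iff: "is_ideal I \<Longrightarrow> I = UNIV \<longleftrightarrow> 1 \<in> I"
  unfolding is_ideal_def by (metis UNIV_I UNIV_eq_I mult.right_neutral)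

lemma maximal_ideal_exists: "\<exists>M :: 'a::comm_ring_1 set. maximal_ideal M"
proof -
  define A where "A = {I :: 'a set. is_ideal I \<and> 1 \<notin> I}"
  have "\<exists>M\<in>A. \<forall>I\<in>A. M \<subseteq> I \<longrightarrow> I = M"
  proof (rule subset_Zorn_nonempty)
    have "{0} \<in> A" by (simp add: A_def is_ideal_def)
    then show "A \<noteq> {}" by blast
    fix C assume C: "C \<noteq> {}" "subset.chain A C"
    have CA: "C \<subseteq> A" using C(2) by (simp add: subset.chain_def)
    have lin: "X \<subseteq> Y \<or> Y \<subseteq> X" if "X \<in> C" "Y \<in> C" for X Y
      using C(2) that by (auto simp: subset_chain_def)
    have id: "is_ideal X" "1 \<notin> X" if "X \<in> C" for X using CA that by (auto simp: A_def)
    have "is_ideal (\<Union>C)"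
      unfolding is_ideal_def
    proof (intro conjI ballI allI)
      show "0 \<in> \<Union>C" using C(1) id is_ideal_0 by blast
      show "x + y \<in> \<Union>C" if xy: "x \<in> \<Union>C" "y \<in> \<Union>C" for x y
      proof -
        obtain X Y where "X \<in> C" "Y \<in> C" "x \<in> X" "y \<in> Y" using xy by blast
        then have "\<exists>Z\<in>C. x \<in> Z \<and> y \<in> Z" using lin by blast
        then show ?thesis using id is_ideal_add by blast
      qed
      show "r * x \<in> \<Union>C" if "x \<in> \<Union>C" for r x
        using that id is_ideal_mult by blast
    qed
    then show "\<Union>C \<in> A" using id by (auto simp: A_def)
  qed
  then show ?thesis unfolding A_def maximal_ideal_def by blast
qed

definition some_maximal_ideal :: "'a::comm_ring_1 set" where
  "some_maximal_ideal = (SOME M. maximal_ideal M)"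

lemma some_maximal_ideal: "maximal_ideal some_maximal_ideal"
  unfolding some_maximal_ideal_def using maximal_ideal_exists by (rule someI_ex)

lemma some_maximal_ideal_local: "local_ring_max m \<Longrightarrow> some_maximal_ideal = m"
  using some_maximal_ideal is_ideal_UNIV_iff
  unfolding maximal_ideal_def local_ring_max_def by (metis UNIV_I)

lemma is_ideal_some_maximal_ideal: "is_ideal some_maximal_ideal"
  by (rule some_maximal_ideal[unfolded maximal_ideal_def, THEN conjunct1])

lemma one_notin_some_maximal_ideal: "1 \<notin> some_maximal_ideal"
  by (rule some_maximal_ideal[unfolded maximal_ideal_def, THEN conjunct2, THEN conjunct1])

definition cong_max :: "'a::comm_ring_1 \<Rightarrow> 'a \<Rightarrow> bool" where
  "cong_max x y \<longleftrightarrow> x - y \<in> some_maximal_ideal"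

lemma cong_max_equivp: "equivp (cong_max :: 'a::comm_ring_1 \<Rightarrow> 'a \<Rightarrow> bool)"
proof (rule equivpI)
  let ?m = "some_maximal_ideal :: 'a set"
  show "reflp (cong_max :: 'a \<Rightarrow> _)"
    by (simp add: reflp_def cong_max_def is_ideal_0[OF is_ideal_some_maximal_ideal])
  show "symp (cong_max :: 'a \<Rightarrow> _)"
    using is_ideal_mult[OF is_ideal_some_maximal_ideal, of _ "-1"]
    by (fastforce simp: symp_def cong_max_def)
  show "transp (cong_max :: 'a \<Rightarrow> _)"
    using is_ideal_add[OF is_ideal_some_maximal_ideal]
    by (fastforce simp: transp_def cong_max_def)
qed

text \<open>Types cannot depend on the maximal ideal of the theorem, so the residue field is taken at an
  arbitrary maximal ideal of the ring; in a local ring this is the right one.\<close>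
quotient_type (overloaded) 'a residue = "'a::comm_ring_1" / cong_max
  by (rule cong_max_equivp)

instantiation residue :: (comm_ring_1) comm_ring_1
begin

lift_definition zero_residue :: "'a residue" is 0 .
lift_definition one_residue :: "'a residue" is 1 .
lift_definition plus_residue :: "'a residue \<Rightarrow> 'a residue \<Rightarrow> 'a residue" is "(+)"
  using is_ideal_add[OF is_ideal_some_maximal_ideal]
  by (fastforce simp: cong_max_def algebra_simps)
lift_definition uminus_residue :: "'a residue \<Rightarrow> 'a residue" is uminus
  using is_ideal_mult[OF is_ideal_some_maximal_ideal, of _ "-1"]
  by (fastforce simp: cong_max_def algebra_simps)
lift_definition minus_residue :: "'a residue \<Rightarrow> 'a residue \<Rightarrow> 'a residue" is "(-)"
proof -
  fix x x' y y' :: 'a assume "cong_max x x'" "cong_max y y'"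
  then have "(x - x') + (- 1) * (y - y') \<in> some_maximal_ideal"
    unfolding cong_max_def
    by (intro is_ideal_add is_ideal_mult is_ideal_some_maximal_ideal)
  then show "cong_max (x - y) (x' - y')" by (simp add: cong_max_def algebra_simps)
qed
lift_definition times_residue :: "'a residue \<Rightarrow> 'a residue \<Rightarrow> 'a residue" is "(*)"
proof -
  fix x x' y y' :: 'a assume "cong_max x x'" "cong_max y y'"
  then have "y * (x - x') + x' * (y - y') \<in> some_maximal_ideal"
    unfolding cong_max_def
    by (intro is_ideal_add is_ideal_mult is_ideal_some_maximal_ideal)
  then show "cong_max (x * y) (x' * y')" by (simp add: cong_max_def algebra_simps)
qed

instance
proof
  fix a b c :: "'a residue"
  have refl: "cong_max z z" for z :: 'a using cong_max_equivp by (rule equivp_reflp)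
  show "a * b * c = a * (b * c)" by transfer (simp add: mult.assoc refl)
  show "a * b = b * a" by transfer (simp add: mult.commute refl)
  show "1 * a = a" by transfer (simp add: refl)
  show "a + b + c = a + (b + c)" by transfer (simp add: add.assoc refl)
  show "a + b = b + a" by transfer (simp add: add.commute refl)
  show "0 + a = a" by transfer (simp add: refl)
  show "- a + a = 0" by transfer (simp add: refl)
  show "a - b = a + - b" by transfer (simp add: refl)
  show "(a + b) * c = a * c + b * c" by transfer (simp add: distrib_right refl)
  show "(0 :: 'a residue) \<noteq> 1"
  proof
    assume "(0 :: 'a residue) = 1"
    then have "cong_max (0 :: 'a) 1" by transfer
    then have "- 1 * (- 1 :: 'a) \<in> some_maximal_ideal"
      unfolding cong_max_def by (intro is_ideal_mult is_ideal_some_maximal_ideal) simp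
    then show False using one_notin_some_maximal_ideal[where 'a = 'a] by simp
  qed
qed

end

lemma abs_residue_hom:
  "abs_residue (x + y) = abs_residue x + abs_residue y"
  "abs_residue (x * y) = abs_residue x * abs_residue y"
  "abs_residue 1 = 1"
  by (simp_all add: plus_residue.abs_eq times_residue.abs_eq one_residue.abs_eq)

lemma abs_residue_eq_0_iff: "abs_residue x = 0 \<longleftrightarrow> x \<in> some_maximal_ideal"
  by (simp add: zero_residue.abs_eq residue.abs_eq_iff cong_max_def)

lemma surj_abs_residue: "surj abs_residue"
  unfolding surj_def by (metis Quotient_residue Quotient_abs_rep)

lemma residue_inverse_exists:
  assumes "a \<noteq> (0 :: 'a::comm_ring_1 residue)"
  shows "\<exists>b. b * a = 1"
proof -
  obtain x where x: "a = abs_residue x" using surj_abs_residue by (metis surjD)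
  let ?M = "Idl some_maximal_ideal :: 'a idl"
  have M: "elts ?M = some_maximal_ideal" by (rule elts_Idl) (rule is_ideal_some_maximal_ideal)
  have "x \<notin> some_maximal_ideal" using assms x abs_residue_eq_0_iff by blast
  moreover have "x \<in> elts (?M + prin x)" "some_maximal_ideal \<subseteq> elts (?M + prin x)"
    using idl_le_plus(1)[of ?M "prin x"] by (auto simp: less_eq_idl_def M intro: elts_plusI2)
  ultimately have "1 \<in> elts (?M + prin x)"
    using some_maximal_ideal is_ideal_elts unfolding maximal_ideal_def by metis
  then obtain u r where "u \<in> some_maximal_ideal" "1 = u + r * x"
    by (auto simp: elts_plus elts_prin M)
  then have "abs_residue r * a = 1"
    using abs_residue_eq_0_iff[of u] unfolding x
    by (metis abs_residue_hom add.left_neutral)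
  then show ?thesis ..
qed

instantiation residue :: (comm_ring_1) field
begin

definition inverse_residue :: "'a residue \<Rightarrow> 'a residue" where
  "inverse_residue a = (if a = 0 then 0 else (SOME b. b * a = 1))"
definition divide_residue :: "'a residue \<Rightarrow> 'a residue \<Rightarrow> 'a residue" where
  "divide_residue a b = a * inverse b"

instance
proof
  fix a b :: "'a residue"
  show "inverse a * a = 1" if "a \<noteq> 0"
    using someI_ex[OF residue_inverse_exists[OF that]] that by (simp add: inverse_residue_def)
qed (simp_all add: inverse_residue_def divide_residue_def)

end

subsection \<open>The theorem\<close>

lemma power_Gen_le:
  assumes "finite S" "\<And>s. s \<in> S \<Longrightarrow> \<exists>n. s ^ n \<in> elts J"
  shows "\<exists>n. Gen S ^ n \<le> J"
  using assms
proof (induction S rule: finite_induct)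
  case empty
  show ?case by (rule exI[of _ 1]) (simp add: Gen_empty)
next
  case (insert s S)
  then obtain n where n: "Gen S ^ n \<le> J" by auto
  obtain t where "s ^ t \<in> elts J" using insert.prems by blast
  then have t: "prin s ^ t \<le> J" by (simp add: prin_le_iff flip: prin_power)
  have "Gen (insert s S) ^ (t + n) \<le> prin s ^ t * Gen (insert s S) ^ n + Gen S ^ n * Gen (insert s S) ^ t"
    unfolding Gen_insert by (rule idl_power_plus_split)
  also have "\<dots> \<le> J"
    by (intro idl_plus_le order_trans[OF idl_mult_le(1)] n t)
  finally show ?case ..
qed

lemma least_generators:
  fixes J :: "'a::comm_ring_1 idl"
  assumes "noetherian_ring TYPE('a)"
  obtains x :: "nat \<Rightarrow> 'a" and d where "J = Gen (x ` {..<d})"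
    and "\<And>T. finite T \<Longrightarrow> J = Gen T \<Longrightarrow> d \<le> card T"
proof -
  obtain F where "finite F" "J = Gen F" using assms by (rule noetherian_Gen)
  then have "finite F \<and> J = Gen F" by simp
  from ex_has_least_nat[where P = "\<lambda>S. finite S \<and> J = Gen S" and m = card, OF this]
  obtain S where S: "finite S" "J = Gen S"
    and least: "\<And>T. finite T \<Longrightarrow> J = Gen T \<Longrightarrow> card S \<le> card T" by auto
  obtain x where "S = x ` {..<card S}"
    using ex_bij_betw_nat_finite[OF S(1)] by (metis bij_betw_imp_surj_on atLeast0LessThan)
  then show ?thesis using that[of x "card S"] S least by simp
qed

theorem theorem4p6:
  fixes m I J :: "'a::comm_ring_1 set"
  assumes "noetherian_ring TYPE('a)"
    and "local_ring_max m"
    and "residue_field_alg_closed m"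
    and "residue_field_char_0 m"
    and "is_ideal I"
    and "m_primary m I"
    and "is_minimal_reduction J I"
  shows "ideal_sum J (I_gt I) = weak_subint_closure J"
proof -
  note noeth = assms(1)
  have "is_ideal J" using assms(7) by (simp add: is_minimal_reduction_def is_reduction_def)
  then obtain J' where J': "J = elts J'" by (metis elts_Idl)
  obtain I' where I': "I = elts I'" using assms(5) by (metis elts_Idl)
  obtain M where M: "m = elts M" using assms(2) by (metis elts_Idl local_ring_max_def)
  have red: "red J' I'"
    using assms(7) is_reduction_iff_red[OF noeth] by (simp add: is_minimal_reduction_def J' I')
  have minimal: "K = J'" if "red K J'" for K
  proof -
    have "is_reduction (elts K) I" "elts K \<subseteq> J"
      using red_trans[OF that red] that is_reduction_iff_red[OF noeth]
      by (auto simp: I' J' red_def less_eq_idl_def)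
    then have "elts K = J" using assms(7) unfolding is_minimal_reduction_def by blast
    then show ?thesis unfolding J' by (rule idl_eqI)
  qed
  obtain x d where xd: "J' = Gen (x ` {..<d})" "\<And>T. finite T \<Longrightarrow> J' = Gen T \<Longrightarrow> d \<le> card T"
    using least_generators[OF noeth] by blast
  interpret minimal_generators "abs_residue :: 'a \<Rightarrow> 'a residue" M J' x d
  proof
    show "abs_residue y = (0 :: 'a residue) \<longleftrightarrow> y \<in> elts M" for y :: 'a
      using some_maximal_ideal_local[OF assms(2)] by (simp add: abs_residue_eq_0_iff M)
  qed (fact noeth assms(2-4)[unfolded M] abs_residue_hom surj_abs_residue xd minimal)+
  obtain S where S: "finite S" "M = Gen S" using noeth by (rule noetherian_Gen)
  have "\<exists>n. s ^ n \<in> elts J'" if "s \<in> S" for s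
  proof -
    have "s \<in> elts M" using that ideal_gen_superset by (auto simp: S elts_Gen)
    then have "s \<in> ideal_radical I" using assms(6) by (simp add: m_primary_def M)
    then obtain k where "s ^ k \<in> elts I'" by (auto simp: ideal_radical_def I')
    then have "red J' (J' + prin (s ^ k))" using red by (intro red_imp_integral[OF noeth])
    then obtain n where "(s ^ k) ^ Suc n \<in> elts (J' * (J' + prin (s ^ k)) ^ n)"
      unfolding red_plus_prin_iff ..
    then have "s ^ (k * Suc n) \<in> elts J'"
      unfolding power_mult by (rule idl_leD[OF idl_mult_le(1)])
    then show ?thesis ..
  qed
  then obtain t where t: "M ^ t \<le> J'" using power_Gen_le[OF S(1)] S(2) by blast
  have "I_gt (elts J') \<subseteq> I_gt (elts I')"
  proof -
    have "J' ^ n \<le> I' ^ n" for n using red by (intro idl_power_mono) (simp add: red_def)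
    then show ?thesis unfolding subset_iff I_gt_iff by (meson idl_leD)
  qed
  then have "weak_subint_closure J \<subseteq> ideal_sum J (I_gt I)"
    using weak_subint_closure_decompose[OF _ t]
    unfolding J' I' subset_iff ideal_sum_I_gt_iff by (metis add_diff_cancel_left' add.commute diff_add_cancel)
  moreover have "ideal_sum J (I_gt I) \<subseteq> weak_subint_closure J"
    unfolding J' I' by (rule ideal_sum_le_weak_subint_closure[OF red])
  ultimately show ?thesis by blast
qed

end
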